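(* Let $f:\{0,1\}^N\to\{0,1\}$ be the AND of $N^{1/3}$ ORs of $N^{2/3}$ variables each (each variable appearing in exactly one OR). Then $Q_0(f)\in \Theta(N^{2/3})$ and $R_2(f)\in\Omega(N)$.
   Context: In the quantum query model the input $x\in\{0,1\}^N$ is accessed only via the gate $|j,b\rangle\mapsto|j,b\oplus x_j\rangle$, interleaved with input-independent unitaries. $Q_0(f)$ is the minimal worst-case number of queries of a zero-error quantum algorithm: on each input it outputs $f(x)$ or "don't know", never a wrong value, and "don't know" with probability $\le 1/2$. $R_2(f)$ is the minimal worst-case number of queries of a classical randomized decision tree that outputs $f(x)$ with probability $\ge 2/3$ on every input. *)

theory Defs
  imports
    "HOL-Probability.Probability_Mass_Function"
    "HOL-Library.Landau_Symbols"
    "HOL-Library.Disjoint_Sets"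
    "Jordan_Normal_Form.Schur_Decomposition"
begin

unbundle no vec_syntax

text \<open>Inputs \<open>x \<in> {0,1}\<^sup>N\<close> are Boolean lists of length \<open>N\<close>; the variables are \<open>x ! j\<close>, \<open>j < N\<close>.\<close>

definition cube :: "nat \<Rightarrow> bool list set" where
  "cube N = {x. length x = N}"


definition unitary_mat :: "nat \<Rightarrow> complex mat \<Rightarrow> bool" where
  "unitary_mat d U \<longleftrightarrow>
     U \<in> carrier_mat d d \<and> mat_adjoint U * U = 1\<^sub>m d \<and> U * mat_adjoint U = 1\<^sub>m d"

text \<open>The state space has the computational basis \<open>|j,b,z\<rangle>\<close> with query register \<open>j < N\<close>,
  answer bit \<open>b\<close> and a workspace \<open>z < W\<close> of arbitrary finite dimension. These \<open>2 * N * W\<close> basis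
  states are numbered by \<open>basis_index\<close>, a bijection onto \<open>{..<2 * N * W}\<close>; index \<open>0\<close> is the
  initial state \<open>|0,0,0\<rangle>\<close>.\<close>

definition basis_index :: "nat \<Rightarrow> nat \<Rightarrow> bool \<Rightarrow> nat \<Rightarrow> nat" where
  "basis_index N j b z = 2 * (z * N + j) + of_bool b"

text \<open>The query gate \<open>|j,b,z\<rangle> \<mapsto> |j, b \<oplus> x\<^sub>j, z\<rangle>\<close>.\<close>

definition query_mat :: "nat \<Rightarrow> nat \<Rightarrow> bool list \<Rightarrow> complex mat" where
  "query_mat N W x = mat (2 * N * W) (2 * N * W) (\<lambda>(k, l).
     of_bool (\<exists>j<N. \<exists>b. \<exists>z<W. l = basis_index N j b z \<and> k = basis_index N j (b \<noteq> x ! j) z))"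

text \<open>The state \<open>U\<^sub>T O\<^sub>x U\<^bsub>T-1\<^esub> \<cdots> O\<^sub>x U\<^sub>0 |0\<rangle>\<close> after \<open>T\<close> queries.\<close>

primrec query_state ::
    "nat \<Rightarrow> nat \<Rightarrow> (nat \<Rightarrow> complex mat) \<Rightarrow> bool list \<Rightarrow> nat \<Rightarrow> complex vec" where
  "query_state N W U x 0 = U 0 *\<^sub>v unit_vec (2 * N * W) 0"
| "query_state N W U x (Suc t) =
     U (Suc t) *\<^sub>v (query_mat N W x *\<^sub>v query_state N W U x t)"

text \<open>The final state is measured in the computational basis; \<open>out\<close> assigns an output to each
  basis state, with \<open>None\<close> standing for ``don't know''.\<close>

definition output_prob :: "(nat \<Rightarrow> bool option) \<Rightarrow> complex vec \<Rightarrow> bool option \<Rightarrow> real" where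
  "output_prob out \<psi> r = (\<Sum>k | k < dim_vec \<psi> \<and> out k = r. (cmod (\<psi> $ k))\<^sup>2)"

definition zero_error_quantum ::
    "nat \<Rightarrow> (bool list \<Rightarrow> bool) \<Rightarrow> nat \<Rightarrow> nat \<Rightarrow> (nat \<Rightarrow> complex mat) \<Rightarrow> (nat \<Rightarrow> bool option) \<Rightarrow> bool" where
  "zero_error_quantum N f T W U out \<longleftrightarrow>
     (\<forall>t\<le>T. unitary_mat (2 * N * W) (U t)) \<and>
     (\<forall>x\<in>cube N.
        output_prob out (query_state N W U x T) (Some (\<not> f x)) = 0 \<and>
        output_prob out (query_state N W U x T) None \<le> 1 / 2)"

text \<open>The workspace must be nonempty: with \<open>W = 0\<close> the state space would be zero-dimensional.\<close>

definition Q0 :: "nat \<Rightarrow> (bool list \<Rightarrow> bool) \<Rightarrow> nat" where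
  "Q0 N f = (LEAST T. \<exists>W>0. \<exists>U out. zero_error_quantum N f T W U out)"


datatype dtree = Leaf bool | Query nat dtree dtree

primrec dt_vars :: "dtree \<Rightarrow> nat set" where
  "dt_vars (Leaf r) = {}"
| "dt_vars (Query j s t) = insert j (dt_vars s \<union> dt_vars t)"

text \<open>In \<open>Query j s t\<close>, the subtree \<open>s\<close> is taken if \<open>x\<^sub>j = 0\<close>, and \<open>t\<close> if \<open>x\<^sub>j = 1\<close>.\<close>

primrec dt_eval :: "dtree \<Rightarrow> bool list \<Rightarrow> bool" where
  "dt_eval (Leaf r) x = r"
| "dt_eval (Query j s t) x = (if x ! j then dt_eval t x else dt_eval s x)"

primrec dt_queries :: "dtree \<Rightarrow> bool list \<Rightarrow> nat" where
  "dt_queries (Leaf r) x = 0"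
| "dt_queries (Query j s t) x = Suc (if x ! j then dt_queries t x else dt_queries s x)"

text \<open>A randomized decision tree is a probability distribution over deterministic ones.\<close>

definition bounded_error_randomized ::
    "nat \<Rightarrow> (bool list \<Rightarrow> bool) \<Rightarrow> nat \<Rightarrow> dtree pmf \<Rightarrow> bool" where
  "bounded_error_randomized N f T p \<longleftrightarrow>
     (\<forall>t\<in>set_pmf p. dt_vars t \<subseteq> {..<N} \<and> (\<forall>x\<in>cube N. dt_queries t x \<le> T)) \<and>
     (\<forall>x\<in>cube N. measure_pmf.prob p {t. dt_eval t x = f x} \<ge> 2 / 3)"

definition R2 :: "nat \<Rightarrow> (bool list \<Rightarrow> bool) \<Rightarrow> nat" where
  "R2 N f = (LEAST T. \<exists>p. bounded_error_randomized N f T p)"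


text \<open>\<open>B i\<close>, for \<open>i < n\<close>, is the set of variables of the \<open>i\<close>-th OR.\<close>

definition and_of_ors :: "nat \<Rightarrow> (nat \<Rightarrow> nat set) \<Rightarrow> bool list \<Rightarrow> bool" where
  "and_of_ors n B x \<longleftrightarrow> (\<forall>i<n. \<exists>j\<in>B i. x ! j)"

text \<open>The \<open>N\<close> variables are split into \<open>n\<close> blocks of \<open>s\<close> variables each, every variable being
  in exactly one block.\<close>

definition equal_blocks :: "nat \<Rightarrow> nat \<Rightarrow> nat \<Rightarrow> (nat \<Rightarrow> nat set) \<Rightarrow> bool" where
  "equal_blocks N n s B \<longleftrightarrow>
     disjoint_family_on B {..<n} \<and> (\<Union>i<n. B i) = {..<N} \<and> (\<forall>i<n. card (B i) = s)"

end

theory Submission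
  imports Defs
begin

text \<open>Write \<open>m = n\<^sup>2\<close> for the block size, so that \<open>N = n * m\<close>.

  Randomized lower bound: put a single 1 at a random position of every block, and then erase it in a
  random block. A decision tree notices the change only if it has queried the erased position, and
  finding the 1 of one block takes about \<open>m / 2\<close> queries, so \<open>T\<close> queries find at most
  \<open>2 * T / m\<close> of the \<open>n\<close> positions on average.

  Quantum lower bound: with the other blocks set to 1, an amplitude of the answer 0 is a polynomial of
  degree at most \<open>T\<close> in the \<open>m\<close> variables of one block that vanishes everywhere except at
  the origin, whence \<open>T \<ge> m\<close>.

  Quantum upper bound: go through the blocks in order, running Grover search with a random number of
  iterations below \<open>n\<close> on the current block until it yields a 1. One run costs \<open>O(n)\<close>
  queries and succeeds with probability at least 1/4 on a nonzero block, so after \<open>8 * n\<close> runs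
  the search has, with probability at least 1/2, found a 1 in every block or is stuck in a zero block.
  In the second case \<open>m\<close> classical queries certify that the current block is zero; if they do
  not, the answer is ``don't know''.\<close>

section \<open>Randomized lower bound\<close>

text \<open>The quantum upper bound has to fit an adaptive search into fixed unitaries with a single
  final measurement. Each finished record is therefore swapped into its own history slot and from
  then on only controls later gates. Different histories are orthogonal, so the amplitude of a
  history is a product of conditional amplitudes whose square behaves like the probability of a
  classical adaptive run; the remaining analysis is classical. The iteration count is random because
  the number of 1s in a block is unknown and a fixed count could overshoot. Going through the blocks
  in order makes a stuck search single out one block, so certifying costs \<open>m\<close> queries
  and not \<open>n * m\<close>. The constant 8: a potential that doubles per missing block starts at
  no more than \<open>2 ^ n\<close> and shrinks by 7/8 per run, and
  \<open>(7 / 8) ^ 8 * 2 < 1\<close>. Inconclusive histories have potential at least 2, so Markov's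
  inequality yields 1/2. In the randomized bound, success 2/3 on both inputs of a pair leaves 1/3
  for both at once, hence \<open>n / 3 <= 2 * T / m\<close>.\<close>

primrec query_count :: "nat set \<Rightarrow> dtree \<Rightarrow> bool list \<Rightarrow> nat" where
  "query_count C (Leaf r) x = 0"
| "query_count C (Query j s t) x =
     of_bool (j \<in> C) + (if x ! j then query_count C t x else query_count C s x)"

primrec queried :: "dtree \<Rightarrow> bool list \<Rightarrow> nat set" where
  "queried (Leaf r) x = {}"
| "queried (Query j s t) x = insert j (if x ! j then queried t x else queried s x)"

lemma finite_queried: "finite (queried t x)"
  by (induction t) auto

lemma dt_eval_cong:
  assumes "\<And>j. j \<in> queried t x \<Longrightarrow> x ! j = y ! j"
  shows "dt_eval t y = dt_eval t x"
  using assms by (induction t) (auto split: if_splits)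

lemma sum_query_count_le:
  assumes "finite I" "disjoint_family_on C I"
  shows "(\<Sum>i\<in>I. query_count (C i) t x) \<le> dt_queries t x"
proof (induction t)
  case (Query j s t)
  have "(\<Sum>i\<in>I. of_bool (j \<in> C i)) = card {i\<in>I. j \<in> C i}"
    using assms(1) by (simp add: Int_def)
  also have "\<dots> \<le> 1"
  proof -
    have "{i\<in>I. j \<in> C i} \<subseteq> {i}" if "i \<in> I" "j \<in> C i" for i
      using assms(2) that unfolding disjoint_family_on_def by blast
    then have "\<exists>i. {i\<in>I. j \<in> C i} \<subseteq> {i}" by blast
    then show ?thesis
      by (metis card_mono finite.emptyI finite_insert card_1_singleton_iff One_nat_def)
  qed
  finally show ?case using Query by (auto simp: sum.distrib)
qed auto

text \<open>\<open>A\<close> holds the candidates for the position of the hidden 1. As long as it is not found, all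
  runs follow the run on the blank input \<open>x\<close>, and the \<open>r\<close>-th query to \<open>A\<close> costs every candidate
  that was not hit by the previous ones one query.\<close>

lemma hidden_one_queries:
  assumes "finite A" "A \<subseteq> C" "\<And>j. j \<in> C \<Longrightarrow> j < length x \<and> \<not> x ! j" "dt_vars t \<subseteq> {..<length x}"
  shows "card A * card (queried t x \<inter> A) \<le> 2 * (\<Sum>p\<in>A. query_count C t (x[p := True]))"
  using assms
proof (induction t arbitrary: A)
  case (Query j s t)
  have j: "j < length x" using Query.prems by auto
  \<comment> \<open>The query eliminates a candidate, or is spent on an already eliminated position
    of \<open>C\<close>, or lies outside \<open>C\<close>, where all the runs still agree.\<close>
  consider "j \<in> A" | "j \<in> C - A" | "j \<notin> C" by blast
  then show ?case
  proof cases
    case 1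
    define a where "a = card (A - {j})"
    define k where "k = card (queried s x \<inter> (A - {j}))"
    have xj: "\<not> x ! j" and jC: "j \<in> C" using 1 Query.prems by auto
    have ka: "k \<le> a" unfolding k_def a_def using Query.prems by (intro card_mono) auto
    have IH: "a * k \<le> 2 * (\<Sum>p\<in>A - {j}. query_count C s (x[p := True]))"
      unfolding a_def k_def by (rule Query.IH(1)) (use Query.prems in auto)
    have cA: "card A = Suc a" unfolding a_def
      using 1 Query.prems(1) by (metis card_Suc_Diff1)
    have "queried (Query j s t) x \<inter> A = insert j (queried s x \<inter> (A - {j}))"
      using 1 xj by auto
    then have ck: "card (queried (Query j s t) x \<inter> A) = Suc k"
      unfolding k_def using Query.prems(1) by (simp add: finite_queried)
    let ?c = "query_count C (Query j s t)"
    have "(\<Sum>p\<in>A. ?c (x[p := True]))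
        = query_count C (Query j s t) (x[j := True])
          + (\<Sum>p\<in>A - {j}. query_count C (Query j s t) (x[p := True]))"
      using Query.prems(1) 1 by (rule sum.remove)
    also have "(\<Sum>p\<in>A - {j}. query_count C (Query j s t) (x[p := True]))
        = (\<Sum>p\<in>A - {j}. 1 + query_count C s (x[p := True]))"
      using xj jC by (intro sum.cong) (auto simp: nth_list_update)
    also have "\<dots> = a + (\<Sum>p\<in>A - {j}. query_count C s (x[p := True]))"
      by (simp add: sum.distrib a_def del: One_nat_def)
    finally have e: "(\<Sum>p\<in>A. ?c (x[p := True]))
        = ?c (x[j := True]) + (a + (\<Sum>p\<in>A - {j}. query_count C s (x[p := True])))" .
    \<comment> \<open>The run that finds its 1 at \<open>j\<close> is charged this single query;
      whatever it does afterwards is dropped.\<close>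
    have "?c (x[j := True]) \<ge> 1" using jC by simp
    with e have "1 + a + (\<Sum>p\<in>A - {j}. query_count C s (x[p := True]))
        \<le> (\<Sum>p\<in>A. ?c (x[p := True]))" by linarith
    \<comment> \<open>Doubling gives \<open>2 + 2 * a + a * k\<close> on the other side, which
      suffices because \<open>k <= a\<close>.\<close>
    moreover have "Suc a * Suc k = a * k + a + k + 1" by simp
    ultimately show ?thesis unfolding cA ck using IH ka by linarith
  next
    case 2
    then have xj: "\<not> x ! j" and jC: "j \<in> C" using Query.prems by auto
    have "card A * card (queried s x \<inter> A) \<le> 2 * (\<Sum>p\<in>A. query_count C s (x[p := True]))"
      by (rule Query.IH(1)) (use Query.prems in auto)
    also have "\<dots> \<le> 2 * (\<Sum>p\<in>A. query_count C (Query j s t) (x[p := True]))"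
    proof (intro mult_left_mono sum_mono)
      fix p assume "p \<in> A"
      then have "p \<noteq> j" using 2 by blast
      then show "query_count C s (x[p := True]) \<le> query_count C (Query j s t) (x[p := True])"
        using xj by (simp add: nth_list_update_neq)
    qed simp
    also have "queried s x \<inter> A = queried (Query j s t) x \<inter> A" using 2 xj by auto
    finally show ?thesis .
  next
    case 3
    let ?u = "if x ! j then t else s"
    have eq: "query_count C (Query j s t) (x[p := True]) = query_count C ?u (x[p := True])"
      if "p \<in> A" for p
    proof -
      have "p \<noteq> j" using that 3 Query.prems by auto
      then show ?thesis using 3 by (simp add: nth_list_update_neq)
    qed
    have "card A * card (queried ?u x \<inter> A) \<le> 2 * (\<Sum>p\<in>A. query_count C ?u (x[p := True]))"
      using Query by (cases "x ! j") auto
    also have "queried ?u x \<inter> A = queried (Query j s t) x \<inter> A"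
      using 3 Query.prems by auto
    finally show ?thesis by (simp only: eq cong: sum.cong)
  qed
qed auto

section \<open>The tree that reads every variable\<close>

primrec full_tree :: "nat list \<Rightarrow> (nat set \<Rightarrow> bool) \<Rightarrow> dtree" where
  "full_tree [] F = Leaf (F {})"
| "full_tree (j # js) F = Query j (full_tree js F) (full_tree js (\<lambda>A. F (insert j A)))"

lemma dt_eval_full_tree: "dt_eval (full_tree js F) x = F {j \<in> set js. x ! j}"
proof (induction js arbitrary: F)
  case (Cons j js)
  have "insert j {k \<in> set js. x ! k} = {k \<in> set (j # js). x ! k}" if "x ! j"
    using that by auto
  moreover have "{k \<in> set js. x ! k} = {k \<in> set (j # js). x ! k}" if "\<not> x ! j"
    using that by auto
  ultimately show ?case using Cons by auto
qed auto

lemma dt_vars_full_tree: "dt_vars (full_tree js F) = set js"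
  by (induction js arbitrary: F) auto

lemma dt_queries_full_tree: "dt_queries (full_tree js F) x = length js"
  by (induction js arbitrary: F) auto

text \<open>Makes the \<open>LEAST\<close> in \<open>R2\<close> range over a nonempty set, so that
  its value is attained.\<close>

lemma bounded_error_randomized_exists: "\<exists>T p. bounded_error_randomized N f T p"
proof -
  define t where "t = full_tree [0..<N] (\<lambda>A. f (map (\<lambda>j. j \<in> A) [0..<N]))"
  have "map (\<lambda>j. j \<in> {i \<in> set [0..<N]. x ! i}) [0..<N] = x" if "x \<in> cube N" for x
    using that by (auto simp: cube_def intro: nth_equalityI)
  then have "dt_eval t x = f x" if "x \<in> cube N" for x
    using that unfolding t_def dt_eval_full_tree by simp
  then have "bounded_error_randomized N f N (return_pmf t)"
    unfolding bounded_error_randomized_def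
    by (auto simp: t_def dt_vars_full_tree dt_queries_full_tree measure_return_pmf indicator_def)
  then show ?thesis by blast
qed

text \<open>Exchanging the old value \<open>p i\<close> with the new one \<open>v\<close> is an
  involution on the pairs \<open>(p, v)\<close>: a uniform choice stays uniform when one coordinate
  is drawn again.\<close>

lemma sum_PiE_resample:
  assumes "finite I" "i \<in> I" "\<And>i. i \<in> I \<Longrightarrow> finite (B i)"
  shows "(\<Sum>p\<in>PiE I B. \<Sum>v\<in>B i. g (p(i := v))) = card (B i) * (\<Sum>p\<in>PiE I B. g p :: nat)"
proof -
  have "(\<Sum>p\<in>PiE I B. \<Sum>v\<in>B i. g (p(i := v))) = (\<Sum>(p, v)\<in>PiE I B \<times> B i. g (p(i := v)))"
    by (rule sum.cartesian_product)
  also have "\<dots> = (\<Sum>(p, v)\<in>PiE I B \<times> B i. g p)"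
    by (rule sum.reindex_bij_witness[where i = "\<lambda>(p, v). (p(i := v), p i)"
          and j = "\<lambda>(p, v). (p(i := v), p i)"])
      (use assms in \<open>auto simp: PiE_iff extensional_def\<close>)
  also have "\<dots> = card (B i) * (\<Sum>p\<in>PiE I B. g p)"
    by (simp add: sum.cartesian_product[symmetric] sum_distrib_left)
  finally show ?thesis .
qed

text \<open>A choice \<open>q\<close> places one 1 in every block; \<open>X q\<close> has value 1,
  and \<open>X0 i q\<close>, with block \<open>i\<close> blanked, has value 0. Summing over all
  \<open>q\<close> in \<open>P\<close> takes the place of the hard distribution. Hits are counted on
  \<open>X0 i q\<close>, query costs on \<open>X q\<close>.\<close>

lemma randomized_lower_bound:
  assumes B: "equal_blocks N n m B" and p: "bounded_error_randomized N (and_of_ors n B) T p"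
    and m: "m > 0"
  shows "m * n \<le> 6 * T"
proof -
  define P where "P = PiE {..<n} B"
  define inp where "inp A = map (\<lambda>j. j \<in> A) [0..<N]" for A
  define X where "X q = inp (q ` {..<n})" for q
  define X0 where "X0 i q = inp (q ` ({..<n} - {i}))" for i q
  have cB: "card (B i) = m" and finB: "finite (B i)" and neB: "B i \<noteq> {}" and BN: "B i \<subseteq> {..<N}"
    if "i < n" for i
    using B that m unfolding equal_blocks_def by (auto simp: card_gt_0_iff dest!: spec[of _ i])
  have disj: "i = i'" if "i < n" "i' < n" "j \<in> B i" "j \<in> B i'" for i i' j
    using B that unfolding equal_blocks_def disjoint_family_on_def by blast
  have finP: "finite P" unfolding P_def by (intro finite_PiE) (auto simp: finB)
  have neP: "P \<noteq> {}" unfolding P_def by (simp add: PiE_eq_empty_iff neB)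
  have inp_nth: "inp A ! j \<longleftrightarrow> j \<in> A" if "j < N" for A j
    using that by (simp add: inp_def)
  have len: "length (inp A) = N" for A by (simp add: inp_def)
  have cube: "X q \<in> cube N" "X0 i q \<in> cube N" for q i
    by (auto simp: X_def X0_def cube_def len)
  have qB: "q i \<in> B i" if "q \<in> P" "i < n" for q i
    using that unfolding P_def by auto
  have qN: "q i < N" if "q \<in> P" "i < n" for q i
    using qB[OF that] BN[OF that(2)] by auto
  have fX: "and_of_ors n B (X q)" if "q \<in> P" for q
    unfolding and_of_ors_def X_def
  proof (intro allI impI)
    fix i assume "i < n"
    then show "\<exists>j\<in>B i. inp (q ` {..<n}) ! j"
      using qB[OF that] qN[OF that] by (intro bexI[of _ "q i"]) (auto simp: inp_nth)
  qed
  have X0_blank: "\<not> X0 i q ! j" if "q \<in> P" "i < n" "j \<in> B i" for q i j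
    using that qB[OF that(1)] disj BN[OF that(2)] unfolding X0_def
    by (subst inp_nth) auto
  have fX0: "\<not> and_of_ors n B (X0 i q)" if "q \<in> P" "i < n" for q i
    using X0_blank[OF that] that(2) unfolding and_of_ors_def by blast
  have upd: "(X0 i q)[q i := True] = X q" if "q \<in> P" "i < n" for q i
  proof (rule nth_equalityI)
    fix j assume "j < length ((X0 i q)[q i := True])"
    then have "j < N" by (simp add: X0_def len)
    then show "(X0 i q)[q i := True] ! j = X q ! j"
      using that(2) by (cases "j = q i") (auto simp: X0_def X_def inp_nth nth_list_update len)
  qed (simp add: X_def X0_def len)
  \<comment> \<open>The blanked input forgets \<open>q i\<close>. With the other positions fixed, a
    single blank run thus faces all \<open>m\<close> candidates, the situation of
    \<open>hidden_one_queries\<close>.\<close>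
  have X0_cong: "X0 i (q(i := v)) = X0 i q" for i q v
    unfolding X0_def by (intro arg_cong[where f = inp] image_cong) auto
  define hit where "hit t i q \<longleftrightarrow> q i \<in> queried t (X0 i q)" for t :: dtree and i q
  have block: "m * (\<Sum>q\<in>P. of_bool (hit t i q)) \<le> 2 * (\<Sum>q\<in>P. query_count (B i) t (X q))"
    if i: "i < n" and t: "dt_vars t \<subseteq> {..<N}" for i t
  proof -
    have *: "m * (\<Sum>v\<in>B i. of_bool (hit t i (q(i := v))))
        \<le> 2 * (\<Sum>v\<in>B i. query_count (B i) t (X (q(i := v))))" if q: "q \<in> P" for q
    proof -
      have qv: "q(i := v) \<in> P" if "v \<in> B i" for v
        using q that i unfolding P_def by (auto simp: PiE_iff extensional_def)
      have "card (B i) * card (queried t (X0 i q) \<inter> B i)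
          \<le> 2 * (\<Sum>v\<in>B i. query_count (B i) t ((X0 i q)[v := True]))"
        by (rule hidden_one_queries)
           (use X0_blank[OF q i] finB[OF i] BN[OF i] t in \<open>auto simp: X0_def len\<close>)
      also have "(\<Sum>v\<in>B i. query_count (B i) t ((X0 i q)[v := True]))
          = (\<Sum>v\<in>B i. query_count (B i) t (X (q(i := v))))"
        using upd[OF qv i] by (intro sum.cong) (auto simp: X0_cong)
      also have "card (queried t (X0 i q) \<inter> B i) = (\<Sum>v\<in>B i. of_bool (hit t i (q(i := v))))"
        using finB[OF i] by (simp add: hit_def X0_cong Int_def conj_commute)
      finally show ?thesis unfolding cB[OF i] .
    qed
    have "m * (m * (\<Sum>q\<in>P. of_bool (hit t i q)))
        = (\<Sum>q\<in>P. m * (\<Sum>v\<in>B i. of_bool (hit t i (q(i := v)))))"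
      using sum_PiE_resample[of "{..<n}" i B "\<lambda>q. of_bool (hit t i q)"] i finB cB[OF i]
      unfolding P_def sum_distrib_left[symmetric] by simp
    also have "\<dots> \<le> (\<Sum>q\<in>P. 2 * (\<Sum>v\<in>B i. query_count (B i) t (X (q(i := v)))))"
      by (intro sum_mono *)
    also have "\<dots> = m * (2 * (\<Sum>q\<in>P. query_count (B i) t (X q)))"
      using sum_PiE_resample[of "{..<n}" i B "\<lambda>q. query_count (B i) t (X q)"] i finB cB[OF i]
      unfolding P_def sum_distrib_left[symmetric] by simp
    \<comment> \<open>Resampling produced the same factor \<open>m\<close> on both sides, which
      cancels.\<close>
    finally show ?thesis using m by simp
  qed
  have tree: "m * (\<Sum>q\<in>P. \<Sum>i<n. of_bool (hit t i q)) \<le> 2 * T * card P"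
    if t: "t \<in> set_pmf p" for t
  proof -
    have tv: "dt_vars t \<subseteq> {..<N}" and tT: "dt_queries t (X q) \<le> T" for q
      using p t cube unfolding bounded_error_randomized_def by auto
    have "m * (\<Sum>q\<in>P. \<Sum>i<n. of_bool (hit t i q))
        = (\<Sum>i<n. m * (\<Sum>q\<in>P. of_bool (hit t i q)))"
      by (subst sum.swap) (simp add: sum_distrib_left)
    also have "\<dots> \<le> (\<Sum>i<n. 2 * (\<Sum>q\<in>P. query_count (B i) t (X q)))"
      by (intro sum_mono block tv) auto
    also have "\<dots> = 2 * (\<Sum>q\<in>P. \<Sum>i<n. query_count (B i) t (X q))"
      by (subst sum.swap) (simp add: sum_distrib_left)
    also have "\<dots> \<le> 2 * (\<Sum>q\<in>P. T)"
    proof (intro mult_left_mono sum_mono)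
      fix q
      have "(\<Sum>i<n. query_count (B i) t (X q)) \<le> dt_queries t (X q)"
        using B unfolding equal_blocks_def by (intro sum_query_count_le) auto
      then show "(\<Sum>i<n. query_count (B i) t (X q)) \<le> T" using tT[of q] by simp
    qed auto
    finally show ?thesis by (simp add: mult.commute mult.left_commute)
  qed
  have hit_prob: "measure_pmf.prob p {t. hit t i q} \<ge> 1 / 3" if q: "q \<in> P" and i: "i < n" for i q
  proof -
    \<comment> \<open>Both answers are correct with probability at least 2/3 + 2/3 - 1. The two
      values differ, so such a tree must read the only position where the inputs differ.\<close>
    let ?E1 = "{t. dt_eval t (X q) = and_of_ors n B (X q)}"
    let ?E2 = "{t. dt_eval t (X0 i q) = and_of_ors n B (X0 i q)}"
    have 1: "measure_pmf.prob p ?E1 \<ge> 2 / 3" and 2: "measure_pmf.prob p ?E2 \<ge> 2 / 3"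
      using p cube unfolding bounded_error_randomized_def by blast+
    have "t \<in> {t. hit t i q}" if "t \<in> ?E1 \<inter> ?E2" for t
    proof (rule ccontr)
      assume nh: "t \<notin> {t. hit t i q}"
      have "dt_eval t ((X0 i q)[q i := True]) = dt_eval t (X0 i q)"
        by (rule dt_eval_cong) (use nh in \<open>auto simp: hit_def intro!: nth_list_update_neq[symmetric]\<close>)
      then show False using that fX[OF q] fX0[OF q i] upd[OF q i] by auto
    qed
    then have "measure_pmf.prob p (?E1 \<inter> ?E2) \<le> measure_pmf.prob p {t. hit t i q}"
      by (intro measure_pmf.finite_measure_mono) auto
    moreover have "measure_pmf.prob p (?E1 \<union> ?E2)
        = measure_pmf.prob p ?E1 + measure_pmf.prob p ?E2 - measure_pmf.prob p (?E1 \<inter> ?E2)"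
      by (rule measure_Un3) (auto simp: measure_pmf.fmeasurable_eq_sets)
    moreover have "measure_pmf.prob p (?E1 \<union> ?E2) \<le> 1" by simp
    ultimately show ?thesis using 1 2 by linarith
  qed
  have int: "integrable (measure_pmf p) (\<lambda>t. of_bool (hit t i q) :: real)" for i q
    by (rule measure_pmf.integrable_const_bound[where B = 1]) auto
  have exp_hit: "measure_pmf.expectation p (\<lambda>t. of_bool (hit t i q)) = measure_pmf.prob p {t. hit t i q}"
    for i q
  proof -
    have "(\<lambda>t. of_bool (hit t i q) :: real) = indicator {t. hit t i q}"
      by (auto simp: indicator_def)
    then show ?thesis by simp
  qed
  have "real (m * n * card P) / 3 = m * (\<Sum>q\<in>P. \<Sum>i<n. 1 / 3)"
    by simp
  also have "\<dots> \<le> m * (\<Sum>q\<in>P. \<Sum>i<n. measure_pmf.prob p {t. hit t i q})"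
    by (intro mult_left_mono sum_mono hit_prob) auto
  also have "\<dots> = measure_pmf.expectation p (\<lambda>t. real m * (\<Sum>q\<in>P. \<Sum>i<n. of_bool (hit t i q)))"
    by (simp add: exp_hit[symmetric] int Bochner_Integration.integral_sum
        Bochner_Integration.integrable_sum del: sum_of_bool_eq)
  also have "\<dots> \<le> measure_pmf.expectation p (\<lambda>t. real (2 * T * card P))"
  proof (rule integral_mono_AE)
    show "AE t in measure_pmf p. real m * (\<Sum>q\<in>P. \<Sum>i<n. of_bool (hit t i q)) \<le> real (2 * T * card P)"
    proof (rule AE_pmfI)
      fix t assume "t \<in> set_pmf p"
      from tree[OF this] have "real (m * (\<Sum>q\<in>P. \<Sum>i<n. of_bool (hit t i q))) \<le> real (2 * T * card P)"
        by (rule of_nat_mono)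
      then show "real m * (\<Sum>q\<in>P. \<Sum>i<n. of_bool (hit t i q)) \<le> real (2 * T * card P)" by simp
    qed
  qed (auto intro!: integrable_mult_right Bochner_Integration.integrable_sum int simp del: sum_of_bool_eq)
  also have "\<dots> = real (2 * T * card P)" by simp
  finally have "real (m * n * card P) \<le> real (6 * T * card P)" by simp
  then have "m * n * card P \<le> 6 * T * card P" by (simp only: of_nat_le_iff)
  then show ?thesis using finP neP by (simp add: card_gt_0_iff)
qed

lemma R2_lower_bound:
  assumes "equal_blocks N n m B" "m > 0"
  shows "m * n \<le> 6 * R2 N (and_of_ors n B)"
proof -
  have "\<exists>p. bounded_error_randomized N (and_of_ors n B) (R2 N (and_of_ors n B)) p"
    unfolding R2_def by (rule LeastI_ex) (rule bounded_error_randomized_exists)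
  then show ?thesis using randomized_lower_bound assms by blast
qed

section \<open>Query gate and norm\<close>

definition char_list :: "nat \<Rightarrow> nat set \<Rightarrow> bool list" where
  "char_list N A = map (\<lambda>j. j \<in> A) [0..<N]"

lemma length_char_list [simp]: "length (char_list N A) = N"
  by (simp add: char_list_def)

lemma char_list_nth [simp]: "j < N \<Longrightarrow> char_list N A ! j \<longleftrightarrow> j \<in> A"
  by (simp add: char_list_def)

lemma char_list_in_cube [simp]: "char_list N A \<in> cube N"
  by (simp add: cube_def)

text \<open>The query gate as a permutation of basis indices: the parity of an index is the answer
  bit, and half of the index modulo \<open>N\<close> is the queried variable.\<close>

definition query_flip :: "nat \<Rightarrow> bool list \<Rightarrow> nat \<Rightarrow> nat" where
  "query_flip N x k = (if x ! (k div 2 mod N) then if even k then k + 1 else k - 1 else k)"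

lemma basis_index_inv:
  assumes "j < N"
  shows "basis_index N j b z div 2 mod N = j" "basis_index N j b z div 2 div N = z"
    "even (basis_index N j b z) \<longleftrightarrow> \<not> b"
  using assms by (auto simp: basis_index_def)

lemma basis_index_less:
  assumes "j < N" "z < W"
  shows "basis_index N j b z < 2 * N * W"
proof -
  have "z * N + j < Suc z * N" using assms by simp
  also have "\<dots> \<le> W * N" using assms by (intro mult_le_mono1) auto
  finally show ?thesis by (auto simp: basis_index_def algebra_simps)
qed

lemma basis_index_cases:
  assumes "k < 2 * N * W"
  obtains j b z where "j < N" "z < W" "k = basis_index N j b z"
proof -
  have N: "N > 0" using assms by (cases N) auto
  have "k div 2 < W * N" using assms by (auto simp: algebra_simps)
  then have "k div 2 div N < W" by (simp add: less_mult_imp_div_less)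
  moreover have "k = basis_index N (k div 2 mod N) (odd k) (k div 2 div N)"
    unfolding basis_index_def by (cases "even k") (auto simp: elim!: oddE)
  ultimately show ?thesis using that N by (metis mod_less_divisor)
qed

lemma query_flip_basis_index:
  assumes "j < N"
  shows "query_flip N x (basis_index N j b z) = basis_index N j (b \<noteq> x ! j) z"
  using assms by (auto simp: query_flip_def basis_index_inv) (auto simp: basis_index_def)

lemma query_flip_less: "k < 2 * N * W \<Longrightarrow> query_flip N x k < 2 * N * W"
  by (metis basis_index_cases query_flip_basis_index basis_index_less)

lemma query_flip_invol: "k < 2 * N * W \<Longrightarrow> query_flip N x (query_flip N x k) = k"
proof (erule basis_index_cases)
  fix j b z assume "j < N" "k = basis_index N j b z"
  then show ?thesis by (cases "x ! j") (auto simp: query_flip_basis_index)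
qed

lemma query_mat_dim [simp]: "query_mat N W x \<in> carrier_mat (2 * N * W) (2 * N * W)"
  by (simp add: query_mat_def)

lemma query_mat_index:
  assumes "k < 2 * N * W" "l < 2 * N * W"
  shows "query_mat N W x $$ (k, l) = of_bool (l = query_flip N x k)"
proof -
  have "(\<exists>j<N. \<exists>b. \<exists>z<W. l = basis_index N j b z \<and> k = basis_index N j (b \<noteq> x ! j) z)
      \<longleftrightarrow> l = query_flip N x k" (is "?L \<longleftrightarrow> ?R")
  proof
    assume ?L
    then obtain j b z where "j < N" "l = basis_index N j b z" "k = basis_index N j (b \<noteq> x ! j) z"
      by (elim exE conjE) (rule that)
    then show ?R by (cases "x ! j") (auto simp: query_flip_basis_index)
  next
    assume ?R
    from assms(1) obtain j b z where "j < N" "z < W" "k = basis_index N j b z"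
      by (rule basis_index_cases)
    moreover from this have "k = basis_index N j ((b \<noteq> x ! j) \<noteq> x ! j) z" by (cases "x ! j") auto
    ultimately have "j < N" "z < W" "l = basis_index N j (b \<noteq> x ! j) z"
        "k = basis_index N j ((b \<noteq> x ! j) \<noteq> x ! j) z"
      using \<open>?R\<close> by (simp_all only: query_flip_basis_index)
    then show ?L by (intro exI conjI)
  qed
  then show ?thesis using assms by (simp add: query_mat_def)
qed

lemma mult_mat_vec_index:
  assumes "A \<in> carrier_mat d d" "v \<in> carrier_vec d" "k < d"
  shows "(A *\<^sub>v v) $ k = (\<Sum>l<d. A $$ (k, l) * v $ l)"
  using assms by (auto simp: scalar_prod_def atLeast0LessThan)

lemma query_mat_apply:
  assumes "v \<in> carrier_vec (2 * N * W)" "k < 2 * N * W"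
  shows "(query_mat N W x *\<^sub>v v) $ k = v $ query_flip N x k"
proof -
  have "(query_mat N W x *\<^sub>v v) $ k
      = (\<Sum>l<2 * N * W. if l = query_flip N x k then v $ l else 0)"
    using assms by (subst mult_mat_vec_index[OF query_mat_dim])
      (auto simp: query_mat_index intro!: sum.cong)
  also have "\<dots> = v $ query_flip N x k"
    using query_flip_less[OF assms(2)] by simp
  finally show ?thesis .
qed

lemma mat_adjoint_index:
  assumes "A \<in> carrier_mat d d" "i < d" "j < d"
  shows "mat_adjoint A $$ (i, j) = cnj (A $$ (j, i))"
  using assms by (simp add: mat_adjoint_def mat_of_rows_index)

lemma mat_adjoint_carrier:
  "A \<in> carrier_mat d d \<Longrightarrow> mat_adjoint A \<in> carrier_mat d d"
  by (auto simp: mat_adjoint_def)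

lemma unitary_norm:
  assumes U: "unitary_mat d U" and v: "v \<in> carrier_vec d"
  shows "(\<Sum>k<d. (cmod ((U *\<^sub>v v) $ k))\<^sup>2) = (\<Sum>k<d. (cmod (v $ k))\<^sup>2)"
proof -
  have Uc: "U \<in> carrier_mat d d" and UU: "mat_adjoint U * U = 1\<^sub>m d"
    using U by (auto simp: unitary_mat_def)
  have orth: "(\<Sum>k<d. cnj (U $$ (k, l)) * U $$ (k, l')) = of_bool (l = l')"
    if "l < d" "l' < d" for l l'
  proof -
    have "(mat_adjoint U * U) $$ (l, l') = (\<Sum>k<d. cnj (U $$ (k, l)) * U $$ (k, l'))"
      using that Uc mat_adjoint_carrier[OF Uc]
      by (auto simp: scalar_prod_def mat_adjoint_index atLeast0LessThan intro!: sum.cong)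
    then show ?thesis using that UU by (cases "l = l'") auto
  qed
  have "complex_of_real (\<Sum>k<d. (cmod ((U *\<^sub>v v) $ k))\<^sup>2)
      = (\<Sum>k<d. (\<Sum>l'<d. U $$ (k, l') * v $ l') * cnj (\<Sum>l<d. U $$ (k, l) * v $ l))"
    unfolding of_real_sum
    by (intro sum.cong refl, subst complex_norm_square)
       (auto simp: mult_mat_vec_index[OF Uc v] simp del: index_mult_mat_vec)
  also have "\<dots> = (\<Sum>k<d. \<Sum>l'<d. \<Sum>l<d. (cnj (U $$ (k, l)) * U $$ (k, l')) * (v $ l' * cnj (v $ l)))"
    unfolding cnj_sum sum_product by (intro sum.cong refl) (simp add: mult_ac)
  also have "\<dots> = (\<Sum>l'<d. \<Sum>l<d. \<Sum>k<d. (cnj (U $$ (k, l)) * U $$ (k, l')) * (v $ l' * cnj (v $ l)))"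
    by (subst sum.swap, rule sum.cong[OF refl], rule sum.swap)
  also have "\<dots> = (\<Sum>l'<d. \<Sum>l<d. if l = l' then v $ l' * cnj (v $ l) else 0)"
    unfolding sum_distrib_right[symmetric] by (intro sum.cong refl) (auto simp: orth)
  also have "\<dots> = (\<Sum>l'<d. v $ l' * cnj (v $ l'))" by simp
  also have "\<dots> = complex_of_real (\<Sum>k<d. (cmod (v $ k))\<^sup>2)"
    unfolding of_real_sum by (intro sum.cong refl) (metis complex_norm_square)
  finally show ?thesis by (simp only: of_real_eq_iff)
qed

lemma query_state_carrier:
  assumes "\<And>t. t \<le> T \<Longrightarrow> unitary_mat (2 * N * W) (U t)"
  shows "query_state N W U x T \<in> carrier_vec (2 * N * W)"
proof -
  have "dim_row (U T) = 2 * N * W"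
    using assms[OF order_refl] unfolding unitary_mat_def by (blast dest: carrier_matD(1))
  then show ?thesis by (cases T) (auto intro!: carrier_vecI)
qed

text \<open>Lets the three output probabilities add up to 1, the fact that the quantum lower bound
  contradicts.\<close>

lemma query_state_norm:
  assumes "N > 0" "W > 0" "\<And>t. t \<le> T \<Longrightarrow> unitary_mat (2 * N * W) (U t)"
  shows "(\<Sum>k<2 * N * W. (cmod (query_state N W U x T $ k))\<^sup>2) = 1"
  using assms(3)
proof (induction T)
  case 0
  have "(\<Sum>k<2 * N * W. (cmod (unit_vec (2 * N * W) 0 $ k))\<^sup>2)
      = (\<Sum>k<2 * N * W. if k = 0 then 1 else 0)"
    using assms(1,2) by (intro sum.cong) (auto simp: unit_vec_def)
  then show ?case
    using 0 assms(1,2) unitary_norm[of "2 * N * W" "U 0" "unit_vec (2 * N * W) 0"] by simp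
next
  case (Suc T)
  let ?\<psi> = "query_state N W U x T"
  have c: "?\<psi> \<in> carrier_vec (2 * N * W)"
    using Suc.prems by (intro query_state_carrier) auto
  have "(\<Sum>k<2 * N * W. (cmod (query_state N W U x (Suc T) $ k))\<^sup>2)
      = (\<Sum>k<2 * N * W. (cmod ((query_mat N W x *\<^sub>v ?\<psi>) $ k))\<^sup>2)"
    unfolding query_state.simps
    by (rule unitary_norm) (use Suc.prems mult_mat_vec_carrier[OF query_mat_dim c] in auto)
  also have "\<dots> = (\<Sum>k<2 * N * W. (cmod (?\<psi> $ query_flip N x k))\<^sup>2)"
    using c by (intro sum.cong) (auto simp: query_mat_apply simp del: index_mult_mat_vec)
  also have "\<dots> = (\<Sum>k<2 * N * W. (cmod (?\<psi> $ k))\<^sup>2)"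
    by (rule sum.reindex_bij_witness[where i = "query_flip N x" and j = "query_flip N x"])
       (auto simp: query_flip_invol query_flip_less)
  also have "\<dots> = 1" using Suc by auto
  finally show ?case .
qed

section \<open>Quantum lower bound\<close>

text \<open>A polynomial of degree at most \<open>T\<close> in the input bits has this property; working with the
  alternating sums avoids polynomials altogether.\<close>

definition alternating_sums_vanish :: "nat \<Rightarrow> nat \<Rightarrow> (bool list \<Rightarrow> complex) \<Rightarrow> bool" where
  "alternating_sums_vanish N T g \<longleftrightarrow>
     (\<forall>Y S. S \<subseteq> {..<N} \<and> Y \<inter> S = {} \<and> T < card S \<longrightarrow>
        (\<Sum>A\<in>Pow S. (- 1) ^ card A * g (char_list N (Y \<union> A))) = 0)"

lemma sum_Pow_insert:
  fixes h :: "'a set \<Rightarrow> 'b :: comm_monoid_add"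
  assumes "finite S" "j \<notin> S"
  shows "(\<Sum>A\<in>Pow (insert j S). h A) = (\<Sum>A\<in>Pow S. h A) + (\<Sum>A\<in>Pow S. h (insert j A))"
proof -
  have "inj_on (insert j) (Pow S)"
    using assms(2) by (auto simp: inj_on_def)
  then show ?thesis
    unfolding Pow_insert using assms
    by (subst sum.union_disjoint) (auto simp: sum.reindex)
qed

text \<open>For any \<open>j\<close> in \<open>S\<close>, the terms of \<open>A\<close> and
  \<open>insert j A\<close> cancel.\<close>

lemma alternating_sums_vanish_const: "alternating_sums_vanish N 0 (\<lambda>x. c)"
  unfolding alternating_sums_vanish_def
proof (intro allI impI, elim conjE)
  fix Y S :: "nat set"
  assume S: "S \<subseteq> {..<N}" "0 < card S"
  then obtain j where j: "j \<in> S" by fastforce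
  define S' where "S' = S - {j}"
  have S': "S = insert j S'" "j \<notin> S'" "finite S'"
    using S j finite_subset by (auto simp: S'_def)
  have "card (insert j A) = Suc (card A)" if "A \<in> Pow S'" for A
    using that S' by (subst card_insert_disjoint) (auto intro: finite_subset)
  then show "(\<Sum>A\<in>Pow S. (- 1) ^ card A * c) = 0"
    unfolding S'(1) by (subst sum_Pow_insert[OF S'(3,2)]) (simp add: sum_negf)
qed

lemma alternating_sums_vanish_sum:
  assumes "\<And>l. l \<in> L \<Longrightarrow> alternating_sums_vanish N T (g l)"
  shows "alternating_sums_vanish N T (\<lambda>x. \<Sum>l\<in>L. c l * g l x)"
  unfolding alternating_sums_vanish_def
proof (intro allI impI)
  fix Y S :: "nat set"
  assume H: "S \<subseteq> {..<N} \<and> Y \<inter> S = {} \<and> T < card S"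
  have "(\<Sum>A\<in>Pow S. (- 1) ^ card A * (\<Sum>l\<in>L. c l * g l (char_list N (Y \<union> A))))
      = (\<Sum>l\<in>L. c l * (\<Sum>A\<in>Pow S. (- 1) ^ card A * g l (char_list N (Y \<union> A))))"
    unfolding sum_distrib_left by (subst sum.swap) (simp add: mult.left_commute)
  also have "\<dots> = 0"
    using assms H unfolding alternating_sums_vanish_def by (intro sum.neutral) auto
  finally show "(\<Sum>A\<in>Pow S. (- 1) ^ card A * (\<Sum>l\<in>L. c l * g l (char_list N (Y \<union> A)))) = 0" .
qed

text \<open>Multiplying by a literal raises the degree by one. If \<open>j\<close> is outside
  \<open>S\<close>, then \<open>Y\<close> decides the branch. Otherwise splitting at
  \<open>j\<close> leaves a sum of \<open>g\<close> and a sum of \<open>h\<close> (with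
  \<open>j\<close> moved into \<open>Y\<close>) over a set that has lost one element but is still
  larger than \<open>T\<close>.\<close>

lemma alternating_sums_vanish_branch:
  assumes g: "alternating_sums_vanish N T g" and h: "alternating_sums_vanish N T h" and j: "j < N"
  shows "alternating_sums_vanish N (Suc T) (\<lambda>x. if x ! j then h x else g x)"
  unfolding alternating_sums_vanish_def
proof (intro allI impI, elim conjE)
  fix Y S :: "nat set"
  let ?s = "\<lambda>A. (- 1) ^ card A * (if char_list N (Y \<union> A) ! j then h (char_list N (Y \<union> A))
    else g (char_list N (Y \<union> A)))"
  assume S: "S \<subseteq> {..<N}" and disj: "Y \<inter> S = {}" and card: "Suc T < card S"
  show "sum ?s (Pow S) = 0"
  proof (cases "j \<in> S")
    case False
    let ?u = "if j \<in> Y then h else g"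
    have "sum ?s (Pow S) = (\<Sum>A\<in>Pow S. (- 1) ^ card A * ?u (char_list N (Y \<union> A)))"
      using False j by (intro sum.cong) auto
    also have "\<dots> = 0"
      using g h S disj card unfolding alternating_sums_vanish_def by auto
    finally show ?thesis .
  next
    case True
    define S' where "S' = S - {j}"
    have S': "S = insert j S'" "j \<notin> S'" "finite S'" and cS': "T < card S'"
      using S True card finite_subset by (auto simp: S'_def)
    have "sum ?s (Pow S') = (\<Sum>A\<in>Pow S'. (- 1) ^ card A * g (char_list N (Y \<union> A)))"
      using S'(2) True disj j by (intro sum.cong) auto
    also have "\<dots> = 0"
      using g S S' cS' disj unfolding alternating_sums_vanish_def by auto
    finally have 1: "sum ?s (Pow S') = 0" .
    have "?s (insert j A) = - ((- 1) ^ card A * h (char_list N (insert j Y \<union> A)))"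
      if "A \<in> Pow S'" for A
    proof -
      have "card (insert j A) = Suc (card A)"
        using that S' by (subst card_insert_disjoint) (auto intro: finite_subset)
      then show ?thesis using j by simp
    qed
    then have "(\<Sum>A\<in>Pow S'. ?s (insert j A))
        = - (\<Sum>A\<in>Pow S'. (- 1) ^ card A * h (char_list N (insert j Y \<union> A)))"
      by (simp add: sum_negf)
    also have "(\<Sum>A\<in>Pow S'. (- 1) ^ card A * h (char_list N (insert j Y \<union> A))) = 0"
      by (rule h[unfolded alternating_sums_vanish_def, rule_format]) (use S S' cS' disj in auto)
    finally show ?thesis
      unfolding S'(1) sum_Pow_insert[OF S'(3,2)] using 1 by simp
  qed
qed

text \<open>A query turns each amplitude into a branch on one input bit, and an input-independent
  unitary only forms linear combinations.\<close>

lemma query_state_alternating_sums_vanish: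
  assumes "\<And>t. t \<le> T \<Longrightarrow> unitary_mat (2 * N * W) (U t)" "k < 2 * N * W"
  shows "alternating_sums_vanish N T (\<lambda>x. query_state N W U x T $ k)"
  using assms
proof (induction T arbitrary: k)
  case 0
  then show ?case by (simp add: alternating_sums_vanish_const)
next
  case (Suc T)
  let ?d = "2 * N * W"
  \<comment> \<open>The part of \<open>query_flip\<close> without \<open>x\<close>: both branches
    then refer to fixed amplitudes, and only the choice between them depends on the input.\<close>
  define flip :: "nat \<Rightarrow> nat" where "flip l = (if even l then l + 1 else l - 1)" for l
  have N: "N > 0" using Suc.prems(2) by (cases N) auto
  have c: "query_state N W U x T \<in> carrier_vec ?d" for x
    using Suc.prems by (intro query_state_carrier) auto
  have U: "U (Suc T) \<in> carrier_mat ?d ?d"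
    using Suc.prems(1)[of "Suc T"] by (simp add: unitary_mat_def)
  have flip: "flip l < ?d" if "l < ?d" for l
    using that by (auto simp: flip_def elim!: evenE)
  have "query_state N W U x (Suc T) $ k = (\<Sum>l<?d. U (Suc T) $$ (k, l) *
      (if x ! (l div 2 mod N) then query_state N W U x T $ flip l else query_state N W U x T $ l))" for x
    unfolding query_state.simps
    by (subst mult_mat_vec_index[OF U mult_mat_vec_carrier[OF query_mat_dim c] Suc.prems(2)])
       (auto simp: query_mat_apply[OF c] query_flip_def flip_def simp del: index_mult_mat_vec
          intro!: sum.cong)
  then show ?case
    using Suc N flip
    by (auto intro!: alternating_sums_vanish_sum alternating_sums_vanish_branch)
qed

lemma sum_output_prob:
  assumes "\<psi> \<in> carrier_vec d"
  shows "output_prob out \<psi> None + output_prob out \<psi> (Some b) + output_prob out \<psi> (Some (\<not> b))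
    = (\<Sum>k<d. (cmod (\<psi> $ k))\<^sup>2)"
proof -
  have d: "dim_vec \<psi> = d" using assms by simp
  have eq: "output_prob out \<psi> r = (\<Sum>k<d. if out k = r then (cmod (\<psi> $ k))\<^sup>2 else 0)" for r
    unfolding output_prob_def d by (rule sum.mono_neutral_cong_left) auto
  show ?thesis unfolding eq sum.distrib[symmetric]
  proof (rule sum.cong)
    fix k
    show "(if out k = None then (cmod (\<psi> $ k))\<^sup>2 else 0)
        + (if out k = Some b then (cmod (\<psi> $ k))\<^sup>2 else 0)
        + (if out k = Some (\<not> b) then (cmod (\<psi> $ k))\<^sup>2 else 0) = (cmod (\<psi> $ k))\<^sup>2"
      by (cases "out k"; cases b) auto
  qed simp
qed

text \<open>With all other variables set to 1, an amplitude of the answer 0 must vanish whenever a variable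
  of the first block is 1; below \<open>m\<close> queries it then vanishes on the blank block as well.\<close>

lemma zero_error_lower_bound:
  assumes B: "equal_blocks N n m B" and n: "n > 0" and m: "m > 0" and W: "W > 0"
    and alg: "zero_error_quantum N (and_of_ors n B) T W U out"
  shows "m \<le> T"
proof (rule ccontr)
  assume "\<not> m \<le> T"
  define Y where "Y = {..<N} - B 0"
  have cB: "card (B i) = m" and finB: "finite (B i)" and neB: "B i \<noteq> {}" and BN: "B i \<subseteq> {..<N}"
    if "i < n" for i
    using B that m unfolding equal_blocks_def by (auto simp: card_gt_0_iff dest!: spec[of _ i])
  have BY: "B i \<subseteq> Y" if "i < n" "i \<noteq> 0" for i
  proof -
    have "B i \<inter> B 0 = {}"
      using B that n unfolding equal_blocks_def by (intro disjoint_family_onD[of B "{..<n}"]) auto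
    then show ?thesis using BN[OF that(1)] by (auto simp: Y_def)
  qed
  have N: "N > 0" using neB[OF n] BN[OF n] by auto
  have U: "unitary_mat (2 * N * W) (U t)" if "t \<le> T" for t
    using alg that unfolding zero_error_quantum_def by blast
  have alg': "output_prob out (query_state N W U (char_list N A) T)
        (Some (\<not> and_of_ors n B (char_list N A))) = 0"
      "output_prob out (query_state N W U (char_list N A) T) None \<le> 1 / 2" for A
    using alg char_list_in_cube unfolding zero_error_quantum_def by blast+
  have f1: "and_of_ors n B (char_list N (Y \<union> A))" if A: "A \<subseteq> B 0" "A \<noteq> {}" for A
    unfolding and_of_ors_def
  proof (intro allI impI)
    fix i assume i: "i < n"
    show "\<exists>j\<in>B i. char_list N (Y \<union> A) ! j"
    proof (cases "i = 0")
      case True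
      then show ?thesis using A BN[OF n] by (auto simp: subset_iff)
    next
      case False
      then obtain j where "j \<in> B i" "j \<in> Y" using neB[OF i] BY[OF i] by auto
      then show ?thesis using BN[OF i] by (intro bexI[of _ j]) auto
    qed
  qed
  have f0: "\<not> and_of_ors n B (char_list N Y)"
    unfolding and_of_ors_def using n BN[OF n] by (auto simp: Y_def intro!: exI[of _ 0])
  let ?\<psi> = "\<lambda>x. query_state N W U x T"
  have c: "?\<psi> x \<in> carrier_vec (2 * N * W)" for x by (intro query_state_carrier U)
  have amp: "?\<psi> (char_list N Y) $ k = 0" if k: "k < 2 * N * W" "out k = Some False" for k
  proof -
    have zero: "?\<psi> (char_list N (Y \<union> A)) $ k = 0" if A: "A \<subseteq> B 0" "A \<noteq> {}" for A
    proof -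
      have "output_prob out (?\<psi> (char_list N (Y \<union> A))) (Some False) = 0"
        using alg'(1)[of "Y \<union> A"] f1[OF A] by simp
      then show ?thesis
        using carrier_vecD[OF c] k unfolding output_prob_def
        by (subst (asm) sum_nonneg_eq_0_iff) auto
    qed
    have av: "alternating_sums_vanish N T (\<lambda>x. ?\<psi> x $ k)"
      using U k(1) by (rule query_state_alternating_sums_vanish)
    have "(\<Sum>A\<in>Pow (B 0). (- 1) ^ card A * ?\<psi> (char_list N (Y \<union> A)) $ k) = 0"
      by (rule av[unfolded alternating_sums_vanish_def, rule_format])
         (use BN[OF n] cB[OF n] \<open>\<not> m \<le> T\<close> in \<open>auto simp: Y_def\<close>)
    also have "(\<Sum>A\<in>Pow (B 0). (- 1) ^ card A * ?\<psi> (char_list N (Y \<union> A)) $ k)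
        = (\<Sum>A\<in>{{}}. (- 1) ^ card A * ?\<psi> (char_list N (Y \<union> A)) $ k)"
      using zero finB[OF n] by (intro sum.mono_neutral_right) auto
    finally show ?thesis by simp
  qed
  have "output_prob out (?\<psi> (char_list N Y)) (Some False) = 0"
    unfolding output_prob_def using amp carrier_vecD[OF c] by (intro sum.neutral) auto
  moreover have "output_prob out (?\<psi> (char_list N Y)) (Some True) = 0"
      "output_prob out (?\<psi> (char_list N Y)) None \<le> 1 / 2"
    using alg'[of Y] f0 by simp_all
  \<comment> \<open>The three outcomes have total probability at most 0 + 0 + 1/2, while the state
    has norm 1.\<close>
  ultimately show False
    using sum_output_prob[OF c, of out "char_list N Y" False] query_state_norm[OF N W U] by simp
qed

section \<open>Algorithms on labelled basis states\<close>

lemma mat_adjoint_mult: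
  fixes A B :: "complex mat"
  assumes A: "A \<in> carrier_mat d d" and B: "B \<in> carrier_mat d d"
  shows "mat_adjoint (A * B) = mat_adjoint B * mat_adjoint A"
proof (rule eq_matI)
  have AB: "A * B \<in> carrier_mat d d" using A B by simp
  fix i j
  assume "i < dim_row (mat_adjoint B * mat_adjoint A)" "j < dim_col (mat_adjoint B * mat_adjoint A)"
  then have ij: "i < d" "j < d" using mat_adjoint_carrier[OF A] mat_adjoint_carrier[OF B] by auto
  have "mat_adjoint (A * B) $$ (i, j) = (\<Sum>l<d. cnj (A $$ (j, l) * B $$ (l, i)))"
    using ij A B by (simp add: mat_adjoint_index[OF AB] scalar_prod_def atLeast0LessThan)
  also have "\<dots> = (mat_adjoint B * mat_adjoint A) $$ (i, j)"
    using ij mat_adjoint_carrier[OF A] mat_adjoint_carrier[OF B]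
    by (simp add: scalar_prod_def atLeast0LessThan mat_adjoint_index[OF A] mat_adjoint_index[OF B]
        mult.commute)
  finally show "mat_adjoint (A * B) $$ (i, j) = (mat_adjoint B * mat_adjoint A) $$ (i, j)" .
qed (use mat_adjoint_carrier[OF A] mat_adjoint_carrier[OF B]
      mat_adjoint_carrier[OF mult_carrier_mat[OF A B]] in auto)

lemma unitary_mult:
  assumes "unitary_mat d A" "unitary_mat d B"
  shows "unitary_mat d (A * B)"
proof -
  have A: "A \<in> carrier_mat d d" and A': "mat_adjoint A * A = 1\<^sub>m d"
    and B: "B \<in> carrier_mat d d" and B': "mat_adjoint B * B = 1\<^sub>m d"
    using assms unfolding unitary_mat_def by blast+
  note A1 = mat_adjoint_carrier[OF A] and B1 = mat_adjoint_carrier[OF B]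
  have AB: "A * B \<in> carrier_mat d d" by (rule mult_carrier_mat[OF A B])
  have "mat_adjoint (A * B) * (A * B) = mat_adjoint B * (mat_adjoint A * (A * B))"
    unfolding mat_adjoint_mult[OF A B] by (rule assoc_mult_mat[OF B1 A1 AB])
  also have "mat_adjoint A * (A * B) = (mat_adjoint A * A) * B"
    by (rule assoc_mult_mat[OF A1 A B, symmetric])
  finally have "mat_adjoint (A * B) * (A * B) = 1\<^sub>m d" unfolding A' using B B' by simp
  then show ?thesis unfolding unitary_mat_def
    using AB mat_mult_left_right_inverse[OF mat_adjoint_carrier[OF AB] AB] by blast
qed

text \<open>A query algorithm up to renaming the basis states: \<open>idx\<close> numbers the labels in \<open>K\<close>, and
  \<open>q x\<close> is the action of the query gate on labels.\<close>

locale labelled_basis =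
  fixes N W :: nat and K :: "'k set" and idx :: "'k \<Rightarrow> nat" and k0 :: 'k
    and q :: "bool list \<Rightarrow> 'k \<Rightarrow> 'k"
  assumes bij: "bij_betw idx K {..<2 * N * W}" and k0: "k0 \<in> K" "idx k0 = 0"
    and q: "\<And>x k. k \<in> K \<Longrightarrow> q x k \<in> K \<and> idx (q x k) = query_flip N x (idx k)"
begin

text \<open>The unitaries are chosen before the input. Real amplitudes are enough because all gates
  used below are permutations or real reflections.\<close>

definition reachable :: "nat \<Rightarrow> (bool list \<Rightarrow> 'k \<Rightarrow> real) \<Rightarrow> bool" where
  "reachable T \<psi> \<longleftrightarrow> (\<exists>U. (\<forall>t\<le>T. unitary_mat (2 * N * W) (U t)) \<and>
     (\<forall>x\<in>cube N. \<forall>k\<in>K. query_state N W U x T $ idx k = complex_of_real (\<psi> x k)))"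

lemma finite_K: "finite K"
  using bij bij_betw_finite by blast

lemma idx_less: "k \<in> K \<Longrightarrow> idx k < 2 * N * W"
  using bij by (auto simp: bij_betw_def)

lemma idx_eq_iff: "k \<in> K \<Longrightarrow> l \<in> K \<Longrightarrow> idx k = idx l \<longleftrightarrow> k = l"
  using bij by (auto simp: bij_betw_def inj_on_def)

lemma sum_idx: "(\<Sum>i<2 * N * W. g i) = (\<Sum>k\<in>K. g (idx k))"
  using bij by (simp add: sum.reindex_bij_betw)

lemma reachable_cong:
  assumes "reachable T \<psi>" "\<And>x k. x \<in> cube N \<Longrightarrow> k \<in> K \<Longrightarrow> \<psi> x k = \<psi>' x k"
  shows "reachable T \<psi>'"
  using assms unfolding reachable_def by metis

lemma unitary_one: "unitary_mat d (1\<^sub>m d)"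
proof -
  have "mat_adjoint (1\<^sub>m d :: complex mat) = 1\<^sub>m d"
  proof (rule eq_matI)
    fix i j assume "i < dim_row (1\<^sub>m d :: complex mat)" "j < dim_col (1\<^sub>m d :: complex mat)"
    then have ij: "i < d" "j < d" by auto
    show "mat_adjoint (1\<^sub>m d :: complex mat) $$ (i, j) = 1\<^sub>m d $$ (i, j)"
      unfolding mat_adjoint_index[OF one_carrier_mat ij] using ij by simp
  qed (use mat_adjoint_carrier[OF one_carrier_mat] in auto)
  then show ?thesis by (simp add: unitary_mat_def)
qed

lemma reachable_start: "reachable 0 (\<lambda>x k. of_bool (k = k0))"
  unfolding reachable_def
proof (intro exI[of _ "\<lambda>t. 1\<^sub>m (2 * N * W)"] conjI ballI allI impI)
  fix x k assume "k \<in> K"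
  then show "query_state N W (\<lambda>t. 1\<^sub>m (2 * N * W)) x 0 $ idx k = complex_of_real (of_bool (k = k0))"
    using idx_less[OF k0(1)] idx_less[of k] k0(2) idx_eq_iff[OF _ k0(1), of k]
    by (auto simp: unit_vec_def)
qed (rule unitary_one)

text \<open>The new query is followed by an identity, into which later gates are multiplied.\<close>

lemma reachable_query:
  assumes "reachable T \<psi>"
  shows "reachable (Suc T) (\<lambda>x k. \<psi> x (q x k))"
proof -
  let ?d = "2 * N * W"
  obtain U where U: "\<And>t. t \<le> T \<Longrightarrow> unitary_mat ?d (U t)"
    and \<psi>: "\<And>x k. x \<in> cube N \<Longrightarrow> k \<in> K \<Longrightarrow> query_state N W U x T $ idx k = \<psi> x k"
    using assms unfolding reachable_def by blast
  define V where "V = U(Suc T := 1\<^sub>m ?d)"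
  have V: "query_state N W V x t = query_state N W U x t" if "t \<le> T" for x t
    using that by (induction t) (auto simp: V_def)
  have c: "query_state N W U x T \<in> carrier_vec ?d" for x
    by (rule query_state_carrier[OF U])
  show ?thesis unfolding reachable_def
  proof (intro exI[of _ V] conjI ballI allI impI)
    fix t assume "t \<le> Suc T"
    then show "unitary_mat ?d (V t)" using U unitary_one by (auto simp: V_def le_Suc_eq)
  next
    fix x k assume x: "x \<in> cube N" and k: "k \<in> K"
    have "query_state N W V x (Suc T) = query_mat N W x *\<^sub>v query_state N W U x T"
      unfolding query_state.simps V[OF order_refl]
      using mult_mat_vec_carrier[OF query_mat_dim c] by (simp add: V_def)
    then show "query_state N W V x (Suc T) $ idx k = complex_of_real (\<psi> x (q x k))"
      using query_mat_apply[OF c idx_less[OF k]] q[OF k, of x] \<psi>[OF x] by metis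
  qed
qed

text \<open>A real symmetric matrix with square 1 is unitary. It is absorbed into the last unitary,
  hence costs no query.\<close>

lemma reachable_unitary:
  fixes u :: "'k \<Rightarrow> 'k \<Rightarrow> real"
  assumes "reachable T \<psi>"
    and sym: "\<And>k l. k \<in> K \<Longrightarrow> l \<in> K \<Longrightarrow> u k l = u l k"
    and inv: "\<And>k l. k \<in> K \<Longrightarrow> l \<in> K \<Longrightarrow> (\<Sum>j\<in>K. u k j * u j l) = of_bool (k = l)"
  shows "reachable T (\<lambda>x k. \<Sum>l\<in>K. u k l * \<psi> x l)"
proof -
  let ?d = "2 * N * W"
  define e where "e = inv_into K idx"
  have e: "e i \<in> K" "idx (e i) = i" if "i < ?d" for i
    using that bij unfolding e_def bij_betw_def by (auto simp: inv_into_into f_inv_into_f)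
  have e_idx: "e (idx k) = k" if "k \<in> K" for k
    using that bij unfolding e_def bij_betw_def by (simp add: inv_into_f_f)
  have e_eq: "e i = e j \<longleftrightarrow> i = j" if "i < ?d" "j < ?d" for i j
    using that e by metis
  define M where "M = mat ?d ?d (\<lambda>(i, j). complex_of_real (u (e i) (e j)))"
  have M: "M \<in> carrier_mat ?d ?d" by (simp add: M_def)
  have "mat_adjoint M = M"
  proof (rule eq_matI)
    fix i j assume "i < dim_row M" "j < dim_col M"
    then have ij: "i < ?d" "j < ?d" using M by auto
    show "mat_adjoint M $$ (i, j) = M $$ (i, j)"
      unfolding mat_adjoint_index[OF M ij] using ij sym[OF e(1) e(1), of i j] by (simp add: M_def)
  qed (use mat_adjoint_carrier[OF M] M in auto)
  moreover have "M * M = 1\<^sub>m ?d"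
  proof (rule eq_matI)
    fix i j assume ij: "i < dim_row (1\<^sub>m ?d :: complex mat)" "j < dim_col (1\<^sub>m ?d :: complex mat)"
    then have "(M * M) $$ (i, j) = (\<Sum>l<?d. complex_of_real (u (e i) (e l) * u (e l) (e j)))"
      by (simp add: M_def scalar_prod_def atLeast0LessThan)
    also have "\<dots> = complex_of_real (\<Sum>k\<in>K. u (e i) k * u k (e j))"
      unfolding sum_idx of_real_sum by (intro sum.cong) (auto simp: e_idx)
    also have "\<dots> = of_bool (i = j)"
      using ij e by (simp add: inv e_eq)
    finally show "(M * M) $$ (i, j) = 1\<^sub>m ?d $$ (i, j)" using ij by simp
  qed (use M in auto)
  ultimately have uM: "unitary_mat ?d M" using M by (simp add: unitary_mat_def)
  obtain U where U: "\<And>t. t \<le> T \<Longrightarrow> unitary_mat ?d (U t)"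
    and \<psi>: "\<And>x k. x \<in> cube N \<Longrightarrow> k \<in> K \<Longrightarrow> query_state N W U x T $ idx k = \<psi> x k"
    using assms(1) unfolding reachable_def by blast
  define V where "V = U(T := M * U T)"
  have V: "query_state N W V x t = query_state N W U x t" if "t < T" for x t
    using that by (induction t) (auto simp: V_def)
  have c: "query_state N W U x t \<in> carrier_vec ?d" if "t \<le> T" for x t
    using that U by (intro query_state_carrier) auto
  have UT: "U T \<in> carrier_mat ?d ?d" using U[OF order_refl] unfolding unitary_mat_def by blast
  have VT: "query_state N W V x T = M *\<^sub>v query_state N W U x T" for x
  proof (cases T)
    case 0
    then show ?thesis using M UT by (simp add: V_def)
  next
    case (Suc t)
    then show ?thesis
      using M UT V[of t x] c[of t x] mult_mat_vec_carrier[OF query_mat_dim c[of t x]]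
      by (simp add: V_def)
  qed
  show ?thesis unfolding reachable_def
  proof (intro exI[of _ V] conjI ballI allI impI)
    fix t assume "t \<le> T"
    moreover have "unitary_mat ?d (M * U T)"
      by (rule unitary_mult[OF uM U[OF order_refl]])
    ultimately show "unitary_mat ?d (V t)" using U by (auto simp: V_def)
  next
    fix x k assume x: "x \<in> cube N" and k: "k \<in> K"
    have "query_state N W V x T $ idx k = (\<Sum>i<?d. M $$ (idx k, i) * query_state N W U x T $ i)"
      unfolding VT by (rule mult_mat_vec_index[OF M c[OF order_refl] idx_less[OF k]])
    also have "\<dots> = (\<Sum>l\<in>K. complex_of_real (u k l * \<psi> x l))"
      unfolding sum_idx using k by (intro sum.cong) (auto simp: M_def idx_less e_idx \<psi>[OF x])
    finally show "query_state N W V x T $ idx k = complex_of_real (\<Sum>l\<in>K. u k l * \<psi> x l)"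
      by simp
  qed
qed

lemma reachable_permute:
  assumes "reachable T \<psi>" and \<sigma>: "\<And>k. k \<in> K \<Longrightarrow> \<sigma> k \<in> K \<and> \<sigma> (\<sigma> k) = k"
  shows "reachable T (\<lambda>x k. \<psi> x (\<sigma> k))"
proof -
  have eq: "(\<Sum>l\<in>K. of_bool (l = \<sigma> k) * g l) = (g (\<sigma> k) :: real)" if "k \<in> K" for k g
  proof -
    have "(\<Sum>l\<in>K. of_bool (l = \<sigma> k) * g l) = (\<Sum>l\<in>K. if l = \<sigma> k then g l else 0)"
      by (intro sum.cong) auto
    then show ?thesis using \<sigma>[OF that] finite_K by simp
  qed
  have "reachable T (\<lambda>x k. \<Sum>l\<in>K. of_bool (l = \<sigma> k) * \<psi> x l)"
  proof (rule reachable_unitary[OF assms(1)])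
    fix k l assume k: "k \<in> K" and l: "l \<in> K"
    have "l = \<sigma> k \<longleftrightarrow> k = \<sigma> l" using \<sigma>[OF k] \<sigma>[OF l] by metis
    then show "of_bool (l = \<sigma> k) = (of_bool (k = \<sigma> l) :: real)" by simp
    show "(\<Sum>j\<in>K. of_bool (j = \<sigma> k) * of_bool (l = \<sigma> j)) = (of_bool (k = l) :: real)"
      unfolding eq[OF k] using \<sigma>[OF k] by auto
  qed
  then show ?thesis by (rule reachable_cong) (simp add: eq)
qed

lemma zero_error_quantumI:
  assumes "reachable T \<psi>"
    and correct: "\<And>x k. x \<in> cube N \<Longrightarrow> k \<in> K \<Longrightarrow> \<psi> x k \<noteq> 0 \<Longrightarrow> res k \<noteq> Some (\<not> f x)"
    and conclusive: "\<And>x. x \<in> cube N \<Longrightarrow> (\<Sum>k | k \<in> K \<and> res k = None. (\<psi> x k)\<^sup>2) \<le> 1 / 2"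
  shows "\<exists>U out. zero_error_quantum N f T W U out"
proof -
  let ?d = "2 * N * W"
  obtain U where U: "\<And>t. t \<le> T \<Longrightarrow> unitary_mat ?d (U t)"
    and \<psi>: "\<And>x k. x \<in> cube N \<Longrightarrow> k \<in> K \<Longrightarrow> query_state N W U x T $ idx k = \<psi> x k"
    using assms(1) unfolding reachable_def by blast
  define out where "out i = res (inv_into K idx i)" for i
  have e_idx: "inv_into K idx (idx k) = k" if "k \<in> K" for k
    using that bij unfolding bij_betw_def by (simp add: inv_into_f_f)
  have prob: "output_prob out (query_state N W U x T) r = (\<Sum>k | k \<in> K \<and> res k = r. (\<psi> x k)\<^sup>2)"
    if x: "x \<in> cube N" for x r
  proof -
    have "dim_vec (query_state N W U x T) = ?d"
      using query_state_carrier[OF U] by auto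
    then have "output_prob out (query_state N W U x T) r
        = (\<Sum>i<?d. if out i = r then (cmod (query_state N W U x T $ i))\<^sup>2 else 0)"
      unfolding output_prob_def by (simp only:) (rule sum.mono_neutral_cong_left, auto)
    also have "\<dots> = (\<Sum>k\<in>K. if res k = r then (\<psi> x k)\<^sup>2 else 0)"
      unfolding sum_idx by (intro sum.cong) (auto simp: out_def e_idx \<psi>[OF x])
    also have "\<dots> = (\<Sum>k | k \<in> K \<and> res k = r. (\<psi> x k)\<^sup>2)"
      by (rule sum.mono_neutral_cong_right) (auto simp: finite_K)
    finally show ?thesis .
  qed
  have "zero_error_quantum N f T W U out"
    unfolding zero_error_quantum_def
  proof (intro conjI allI impI ballI U)
    fix x assume x: "x \<in> cube N"
    show "output_prob out (query_state N W U x T) (Some (\<not> f x)) = 0"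
      unfolding prob[OF x] using correct[OF x] by (intro sum.neutral) auto
    show "output_prob out (query_state N W U x T) None \<le> 1 / 2"
      unfolding prob[OF x] by (rule conclusive[OF x])
  qed
  then show ?thesis by blast
qed

end

section \<open>Records and histories\<close>

text \<open>A record \<open>(j, b, r, d)\<close> holds a query position, its answer, the number of iterations of one
  run of the search and a dummy bit: the search space consists of the block and a copy of it with all
  entries 0, so that at most half of its entries are marked. Finished records are swapped into a slot
  of the history.\<close>

type_synonym qrec = "nat \<times> bool \<times> nat \<times> bool"

definition records :: "nat \<Rightarrow> nat \<Rightarrow> qrec set" where
  "records N M = {..<N} \<times> UNIV \<times> {..<M} \<times> UNIV"

definition histories :: "nat \<Rightarrow> nat \<Rightarrow> nat \<Rightarrow> qrec list set" where
  "histories N M L = {h. set h \<subseteq> records N M \<and> length h = L}"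

definition rec0 :: qrec where "rec0 = (0, False, 0, False)"

fun answer_flip :: "bool list \<Rightarrow> qrec \<Rightarrow> qrec" where
  "answer_flip x (j, b, r, d) = (j, b \<noteq> x ! j, r, d)"

lemma finite_records: "finite (records N M)"
  by (simp add: records_def)

lemma finite_histories: "finite (histories N M L)"
  unfolding histories_def using finite_records by (rule finite_lists_length_eq)

lemma rec0_in_records: "N > 0 \<Longrightarrow> M > 0 \<Longrightarrow> rec0 \<in> records N M"
  by (simp add: rec0_def records_def)

lemma sum_records:
  "(\<Sum>v\<in>records N M. g v) = (\<Sum>r<M. \<Sum>j<N. g (j, False, r, False) + g (j, False, r, True)
     + g (j, True, r, False) + g (j, True, r, True))" for g :: "qrec \<Rightarrow> 'a :: comm_monoid_add"
proof -
  have "(\<Sum>v\<in>records N M. g v) = (\<Sum>j<N. \<Sum>b\<in>UNIV. \<Sum>r<M. \<Sum>d\<in>UNIV. g (j, b, r, d))"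
    unfolding records_def by (simp add: sum.cartesian_product)
  also have "\<dots> = (\<Sum>j<N. \<Sum>r<M. g (j, False, r, False) + g (j, False, r, True)
     + g (j, True, r, False) + g (j, True, r, True))"
    by (simp add: UNIV_bool sum.distrib[symmetric] ac_simps)
  finally show ?thesis by (subst sum.swap)
qed

locale record_basis =
  fixes N M L :: nat
  assumes N: "N > 0" and M: "M > 0"
begin

abbreviation "V \<equiv> records N M"
abbreviation "H \<equiv> histories N M L"

definition flip_fst :: "bool list \<Rightarrow> qrec \<times> qrec list \<Rightarrow> qrec \<times> qrec list" where
  "flip_fst x k = (answer_flip x (fst k), snd k)"

lemma basis_exists:
  "\<exists>W>0. \<exists>idx. labelled_basis N W (V \<times> H) idx (rec0, replicate L rec0) flip_fst"
proof -
  define Z where "Z = {..<M} \<times> (UNIV :: bool set) \<times> H"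
  define z0 where "z0 = (0 :: nat, False, replicate L rec0)"
  define W where "W = card Z"
  have finZ: "finite Z" by (simp add: Z_def finite_histories)
  have h0: "replicate L rec0 \<in> H"
    using rec0_in_records[OF N M] by (auto simp: histories_def)
  then have z0: "z0 \<in> Z" using M by (simp add: Z_def z0_def)
  have W: "W > 0" using finZ z0 by (auto simp: W_def card_gt_0_iff)
  obtain e where e: "bij_betw e Z {0..<W}"
    using ex_bij_betw_finite_nat[OF finZ] by (auto simp: W_def)
  define enc where "enc z = Transposition.transpose (e z0) 0 (e z)" for z
  have "bij_betw (Transposition.transpose (e z0) 0) {0..<W} {0..<W}"
    using W e z0 by (intro bij_betw_byWitness[where f' = "Transposition.transpose (e z0) 0"])
      (auto simp: Transposition.transpose_def bij_betw_def)
  from bij_betw_trans[OF e this] have enc: "bij_betw enc Z {0..<W}"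
    unfolding comp_def enc_def[abs_def] .
  have enc0: "enc z0 = 0" by (simp add: enc_def)
  define idx where "idx = (\<lambda>((j, b, r, d), h). basis_index N j b (enc (r, d, h)))"
  have enc_less: "enc (r, d, h) < W" if "r < M" "h \<in> H" for r d h
    using enc that by (auto simp: bij_betw_def Z_def)
  have "inj_on idx (V \<times> H)"
  proof (rule inj_onI)
    fix k k' assume k: "k \<in> V \<times> H" and k': "k' \<in> V \<times> H" and eq: "idx k = idx k'"
    obtain j b r d h where kk: "k = ((j, b, r, d), h)" by (metis prod.exhaust)
    obtain j' b' r' d' h' where kk': "k' = ((j', b', r', d'), h')" by (metis prod.exhaust)
    have j: "j < N" "j' < N" using k k' by (auto simp: kk kk' records_def)
    have eq': "basis_index N j b (enc (r, d, h)) = basis_index N j' b' (enc (r', d', h'))"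
      using eq by (simp add: idx_def kk kk')
    have "j = j'" "enc (r, d, h) = enc (r', d', h')"
      using basis_index_inv(1,2)[OF j(1)] basis_index_inv(1,2)[OF j(2)] eq' by metis+
    moreover have "b = b'"
      using basis_index_inv(3)[OF j(1)] basis_index_inv(3)[OF j(2)] eq' by metis
    moreover have "(r, d, h) = (r', d', h')"
      by (rule inj_onD[OF bij_betw_imp_inj_on[OF enc] calculation(2)])
         (use k k' in \<open>auto simp: Z_def kk kk' records_def\<close>)
    ultimately show "k = k'" by (simp add: kk kk')
  qed
  moreover have "idx ` (V \<times> H) = {..<2 * N * W}"
  proof (intro equalityI subsetI)
    fix i assume "i \<in> idx ` (V \<times> H)"
    then show "i \<in> {..<2 * N * W}"
      by (auto simp: idx_def records_def intro!: basis_index_less enc_less)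
  next
    fix i assume "i \<in> {..<2 * N * W}"
    then obtain j b z where jz: "j < N" "z < W" "i = basis_index N j b z"
      by (auto elim: basis_index_cases)
    from enc jz(2) have "z \<in> enc ` Z" by (auto simp: bij_betw_def)
    then obtain r d h where z: "z = enc (r, d, h)" "r < M" "h \<in> H"
      by (auto simp: Z_def)
    then have "i = idx ((j, b, r, d), h)" "((j, b, r, d), h) \<in> V \<times> H"
      using jz by (auto simp: idx_def records_def)
    then show "i \<in> idx ` (V \<times> H)" by blast
  qed
  ultimately have "bij_betw idx (V \<times> H) {..<2 * N * W}" by (simp add: bij_betw_def)
  moreover have "idx (rec0, replicate L rec0) = 0"
    using enc0 by (simp add: idx_def rec0_def[abs_def] z0_def basis_index_def)
  moreover have "flip_fst x k \<in> V \<times> H \<and> idx (flip_fst x k) = query_flip N x (idx k)"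
    if "k \<in> V \<times> H" for x k
  proof -
    obtain j b r d h where kk: "k = ((j, b, r, d), h)" by (metis prod.exhaust)
    then show ?thesis
      using that by (auto simp: flip_fst_def idx_def records_def query_flip_basis_index)
  qed
  ultimately have "labelled_basis N W (V \<times> H) idx (rec0, replicate L rec0) flip_fst"
    using h0 rec0_in_records[OF N M] by (unfold_locales) auto
  then show ?thesis using W by blast
qed

end

locale record_algorithm = record_basis N M L + labelled_basis N W "V \<times> H" idx "(rec0, replicate L rec0)" flip_fst
  for N M L W :: nat and idx :: "qrec \<times> qrec list \<Rightarrow> nat"
begin

lemma reachable_query_rec:
  assumes "reachable T (\<lambda>x (v, h). \<psi> x v h)"
  shows "reachable (Suc T) (\<lambda>x (v, h). \<psi> x (answer_flip x v) h)"
  using reachable_query[OF assms] by (rule reachable_cong) (auto simp: flip_fst_def)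

text \<open>A gate controlled by the history: it is block diagonal, with one symmetric involution of
  the record space per history.\<close>

lemma reachable_fibrewise:
  assumes "reachable T (\<lambda>x (v, h). \<psi> x v h)"
    and sym: "\<And>h v v'. h \<in> H \<Longrightarrow> v \<in> V \<Longrightarrow> v' \<in> V \<Longrightarrow> w h v v' = w h v' v"
    and inv: "\<And>h v v'. h \<in> H \<Longrightarrow> v \<in> V \<Longrightarrow> v' \<in> V \<Longrightarrow> (\<Sum>u\<in>V. w h v u * w h u v') = of_bool (v = v')"
  shows "reachable T (\<lambda>x (v, h). \<Sum>u\<in>V. w h v u * \<psi> x u h)"
proof -
  have sum: "(\<Sum>l\<in>V \<times> H. of_bool (h = snd l) * g (fst l) (snd l)) = (\<Sum>u\<in>V. g u h :: real)"
    if "h \<in> H" for h g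
  proof -
    have "(\<Sum>l\<in>V \<times> H. of_bool (h = snd l) * g (fst l) (snd l))
        = (\<Sum>u\<in>V. \<Sum>h'\<in>H. of_bool (h = h') * g u h')"
      by (simp add: sum.cartesian_product split_def)
    also have "\<dots> = (\<Sum>u\<in>V. \<Sum>h'\<in>H. if h = h' then g u h' else 0)"
      by (intro sum.cong) auto
    also have "\<dots> = (\<Sum>u\<in>V. g u h)"
      using that by (simp add: finite_histories)
    finally show ?thesis .
  qed
  define u where "u k l = of_bool (snd k = snd l) * w (snd k) (fst k) (fst l)" for k l :: "qrec \<times> qrec list"
  have "reachable T (\<lambda>x k. \<Sum>l\<in>V \<times> H. u k l * (case l of (v, h) \<Rightarrow> \<psi> x v h))"
  proof (rule reachable_unitary[OF assms(1)])
    fix k l assume k: "k \<in> V \<times> H" and l: "l \<in> V \<times> H"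
    then show "u k l = u l k" using sym by (auto simp: u_def)
    have "(\<Sum>j\<in>V \<times> H. u k j * u j l) = (\<Sum>j\<in>V \<times> H. of_bool (snd k = snd j) *
        (of_bool (snd j = snd l) * (w (snd k) (fst k) (fst j) * w (snd j) (fst j) (fst l))))"
      by (simp add: u_def mult_ac)
    also have "\<dots> = (\<Sum>v\<in>V. of_bool (snd k = snd l) * (w (snd k) (fst k) v * w (snd k) v (fst l)))"
      using k by (subst sum) auto
    also have "\<dots> = of_bool (k = l)"
      unfolding sum_distrib_left[symmetric] using k l by (auto simp: inv)
    finally show "(\<Sum>j\<in>V \<times> H. u k j * u j l) = of_bool (k = l)" .
  qed
  then show ?thesis
  proof (rule reachable_cong)
    fix x k assume k: "k \<in> V \<times> H"
    have "(\<Sum>l\<in>V \<times> H. u k l * (case l of (v, h) \<Rightarrow> \<psi> x v h)) = (\<Sum>l\<in>V \<times> H. of_bool (snd k = snd l) *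
        (w (snd k) (fst k) (fst l) * \<psi> x (fst l) (snd l)))"
      by (simp add: u_def mult_ac split_def)
    also have "\<dots> = (\<Sum>v\<in>V. w (snd k) (fst k) v * \<psi> x v (snd k))"
      using k by (subst sum) auto
    finally show "(\<Sum>l\<in>V \<times> H. u k l * (case l of (v, h) \<Rightarrow> \<psi> x v h))
        = (case k of (v, h) \<Rightarrow> \<Sum>u\<in>V. w h v u * \<psi> x u h)"
      by (simp add: split_def)
  qed
qed

lemma reachable_phase:
  assumes "reachable T (\<lambda>x (v, h). \<psi> x v h)"
  shows "reachable T (\<lambda>x (v, h). (if P h v then - \<psi> x v h else \<psi> x v h))"
proof -
  define w where "w h v v' = (if v = v' then if P h v then - 1 else 1 else 0 :: real)" for h v v'
  have eq: "(\<Sum>u\<in>V. w h v u * g u) = (if P h v then - g v else g v)" if "v \<in> V" for h v g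
  proof -
    have "(\<Sum>u\<in>V. w h v u * g u) = (\<Sum>u\<in>V. if v = u then if P h v then - g v else g v else 0)"
      by (intro sum.cong) (auto simp: w_def)
    then show ?thesis using that finite_records by simp
  qed
  have "reachable T (\<lambda>x (v, h). \<Sum>u\<in>V. w h v u * \<psi> x u h)"
  proof (rule reachable_fibrewise[OF assms])
    fix h v v' assume v: "v \<in> V"
    show "w h v v' = w h v' v" by (simp add: w_def)
    show "(\<Sum>u\<in>V. w h v u * w h u v') = of_bool (v = v')"
      unfolding eq[OF v] by (simp add: w_def)
  qed
  then show ?thesis by (rule reachable_cong) (auto simp: eq)
qed

text \<open>Each class of records with the same key \<kappa> carries its own reflection
  \<open>1 - 2 a a^T\<close>. The vector is normalised on every class where it is nonzero; elsewhere
  the gate is the identity.\<close>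

lemma reachable_reflection:
  assumes "reachable T (\<lambda>x (v, h). \<psi> x v h)"
    and a: "\<And>h v. h \<in> H \<Longrightarrow> v \<in> V \<Longrightarrow> a h v \<noteq> 0 \<Longrightarrow> (\<Sum>u\<in>V. of_bool (\<kappa> v = \<kappa> u) * (a h u)\<^sup>2) = (1 :: real)"
  shows "reachable T (\<lambda>x (v, h). \<psi> x v h - 2 * a h v * (\<Sum>u\<in>V. of_bool (\<kappa> v = \<kappa> u) * (a h u * \<psi> x u h)))"
proof -
  define w where "w h v v' = of_bool (v = v') - 2 * a h v * (of_bool (\<kappa> v = \<kappa> v') * a h v')" for h v v'
  have eq: "(\<Sum>u\<in>V. w h v u * g u) = g v - 2 * a h v * (\<Sum>u\<in>V. of_bool (\<kappa> v = \<kappa> u) * (a h u * g u))"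
    if "v \<in> V" for h v g
  proof -
    have "(\<Sum>u\<in>V. w h v u * g u) = (\<Sum>u\<in>V. (if v = u then g u else 0)
        - 2 * a h v * (of_bool (\<kappa> v = \<kappa> u) * (a h u * g u)))"
      by (intro sum.cong) (auto simp: w_def algebra_simps)
    then show ?thesis unfolding sum_subtractf sum_distrib_left[symmetric]
      using that finite_records by simp
  qed
  have "reachable T (\<lambda>x (v, h). \<Sum>u\<in>V. w h v u * \<psi> x u h)"
  proof (rule reachable_fibrewise[OF assms(1)])
    fix h v v' assume h: "h \<in> H" and v: "v \<in> V" and v': "v' \<in> V"
    show "w h v v' = w h v' v" by (auto simp: w_def)
    have "(\<Sum>u\<in>V. of_bool (\<kappa> v = \<kappa> u) * (a h u * w h u v'))
        = (\<Sum>u\<in>V. (if u = v' then of_bool (\<kappa> v = \<kappa> v') * a h v' else 0)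
            - 2 * of_bool (\<kappa> v = \<kappa> v') * a h v' * (of_bool (\<kappa> v' = \<kappa> u) * (a h u)\<^sup>2))"
      by (intro sum.cong) (auto simp: w_def algebra_simps power2_eq_square)
    also have "\<dots> = of_bool (\<kappa> v = \<kappa> v') * a h v'
        - 2 * of_bool (\<kappa> v = \<kappa> v') * a h v' * (\<Sum>u\<in>V. of_bool (\<kappa> v' = \<kappa> u) * (a h u)\<^sup>2)"
      unfolding sum_subtractf sum_distrib_left[symmetric] using v' finite_records by simp
    also have "\<dots> = - of_bool (\<kappa> v = \<kappa> v') * a h v'"
      using a[OF h v'] by (cases "a h v' = 0") auto
    finally have *: "(\<Sum>u\<in>V. of_bool (\<kappa> v = \<kappa> u) * (a h u * w h u v')) = - of_bool (\<kappa> v = \<kappa> v') * a h v'" .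
    show "(\<Sum>u\<in>V. w h v u * w h u v') = of_bool (v = v')"
      unfolding eq[OF v] * by (simp add: w_def)
  qed
  then show ?thesis by (rule reachable_cong) (auto simp: eq)
qed

lemma reachable_relabel:
  assumes "reachable T (\<lambda>x (v, h). \<psi> x v h)"
    and "\<And>h v. h \<in> H \<Longrightarrow> v \<in> V \<Longrightarrow> \<sigma> h v \<in> V \<and> \<sigma> h (\<sigma> h v) = v"
  shows "reachable T (\<lambda>x (v, h). \<psi> x (\<sigma> h v) h)"
  using reachable_permute[OF assms(1), of "\<lambda>(v, h). (\<sigma> h v, h)"] assms(2)
  by (auto simp: split_def)

text \<open>Swapping instead of overwriting keeps the move reversible, and the blank slot comes back
  as the next working record.\<close>

lemma reachable_swap:
  assumes "reachable T (\<lambda>x (v, h). \<psi> x v h)" and t: "t < L"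
  shows "reachable T (\<lambda>x (v, h). \<psi> x (h ! t) (h[t := v]))"
proof -
  have "reachable T (\<lambda>x k. case (snd k ! t, (snd k)[t := fst k]) of (v, h) \<Rightarrow> \<psi> x v h)"
  proof (rule reachable_permute[OF assms(1)])
    fix k assume "k \<in> V \<times> H"
    then obtain v h where k: "k = (v, h)" "v \<in> V" "set h \<subseteq> V" "length h = L"
      by (auto simp: histories_def)
    have "set (h[t := v]) \<subseteq> V" using k by (intro set_update_subsetI)
    moreover have "h ! t \<in> V" using nth_mem[of t h] k t by blast
    ultimately show "(snd k ! t, (snd k)[t := fst k]) \<in> V \<times> H \<and>
        (snd (snd k ! t, (snd k)[t := fst k]) ! t,
         (snd (snd k ! t, (snd k)[t := fst k]))[t := fst (snd k ! t, (snd k)[t := fst k])]) = k"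
      using k t by (simp add: histories_def)
  qed
  then show ?thesis by (simp add: split_def)
qed

end

section \<open>Grover search in one block\<close>

text \<open>The sum telescopes. Divided out, it says that the average is \<open>1 / 2 - sin (4 * M *
  \<theta>) / (4 * M * sin (2 * \<theta>))\<close>, the success probability of Grover search with a
  random number of iterations below \<open>M\<close>.\<close>

lemma sum_sin_sq_odd_multiples:
  fixes \<theta> :: real
  shows "4 * sin (2 * \<theta>) * (\<Sum>r<M. (sin ((2 * real r + 1) * \<theta>))\<^sup>2)
    = 2 * real M * sin (2 * \<theta>) - sin (4 * real M * \<theta>)"
proof (induction M)
  case (Suc M)
  let ?A = "(2 * real M + 1) * \<theta>"
  have 1: "4 * real (Suc M) * \<theta> = 2 * ?A + 2 * \<theta>" "4 * real M * \<theta> = 2 * ?A - 2 * \<theta>"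
    by (simp_all add: algebra_simps)
  have "sin (4 * real (Suc M) * \<theta>) - sin (4 * real M * \<theta>) = 2 * cos (2 * ?A) * sin (2 * \<theta>)"
    unfolding 1 by (simp add: sin_add sin_diff)
  also have "cos (2 * ?A) = 1 - 2 * (sin ?A)\<^sup>2"
    by (rule cos_double_sin)
  finally show ?case using Suc by (simp add: algebra_simps)
qed simp

text \<open>The assumption limits the subtracted term of that average to 1/4.\<close>

lemma average_sin_sq_ge:
  fixes \<theta> :: real
  assumes M: "M > 0" and "sin (2 * \<theta>) \<ge> 1 / real M"
  shows "(\<Sum>r<M. (sin ((2 * real r + 1) * \<theta>))\<^sup>2) / real M \<ge> 1 / 4"
proof -
  let ?S = "\<Sum>r<M. (sin ((2 * real r + 1) * \<theta>))\<^sup>2"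
  have pos: "sin (2 * \<theta>) > 0" using assms by (smt (verit) divide_pos_pos of_nat_0_less_iff)
  have "real M * sin (2 * \<theta>) \<ge> 1" using assms by (simp add: field_simps)
  moreover have "sin (4 * real M * \<theta>) \<le> 1" by simp
  ultimately have "real M * sin (2 * \<theta>) \<le> 4 * sin (2 * \<theta>) * ?S"
    unfolding sum_sin_sq_odd_multiples by linarith
  then have "real M \<le> 4 * ?S" using pos by simp
  then show ?thesis using M by (simp add: field_simps)
qed

locale block_search =
  fixes N n m M :: nat and B :: "nat \<Rightarrow> nat set"
  assumes blocks: "equal_blocks N n m B" and n: "n > 0" and m: "m > 0" and M_pos: "M > 0"
    and M_sq: "m \<le> M\<^sup>2"
begin

lemma finite_block: "c < n \<Longrightarrow> finite (B c)"
  and card_block: "c < n \<Longrightarrow> card (B c) = m"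
  and block_subset: "c < n \<Longrightarrow> B c \<subseteq> {..<N}"
  using blocks m unfolding equal_blocks_def by (auto simp: card_gt_0_iff dest!: spec[of _ c])

lemma N_pos: "N > 0"
  using block_subset[OF n] card_block[OF n] m by (cases N) auto

definition ones :: "bool list \<Rightarrow> nat \<Rightarrow> nat" where
  "ones x c = card {j\<in>B c. x ! j}"

text \<open>The Grover angle: \<open>sin\<close> of it is the overlap of the uniform state on the
  \<open>2 * m\<close> entries with the marked ones. Doubling the space keeps the unmarked part
  nonempty.\<close>

definition angle :: "bool list \<Rightarrow> nat \<Rightarrow> real" where
  "angle x c = arcsin (sqrt (ones x c / (2 * m)))"

text \<open>The state after \<open>i\<close> Grover steps, with the iteration count \<open>r\<close>
  in uniform superposition; the component \<open>r\<close> stops after \<open>r\<close> steps,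
  whence \<open>min i r\<close>. Marked entries share the \<open>sin\<close> part equally, unmarked
  ones the \<open>cos\<close> part. The \<open>sin\<close> branch is entered only if the block
  contains a 1.\<close>

definition search_amp :: "nat \<Rightarrow> bool list \<Rightarrow> nat \<Rightarrow> qrec \<Rightarrow> real" where
  "search_amp i x c = (\<lambda>(j, b, r, d). if b \<or> j \<notin> B c then 0 else
     (if x ! j \<and> \<not> d then sin ((2 * real (min i r) + 1) * angle x c) / sqrt (ones x c)
      else cos ((2 * real (min i r) + 1) * angle x c) / sqrt (2 * real m - ones x c)) / sqrt M)"

lemma ones_le: "c < n \<Longrightarrow> ones x c \<le> m"
  unfolding ones_def using card_mono[OF finite_block, of c] card_block by fastforce

lemma ones_pos_iff: "c < n \<Longrightarrow> ones x c > 0 \<longleftrightarrow> (\<exists>j\<in>B c. x ! j)"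
  unfolding ones_def using finite_block by (auto simp: card_gt_0_iff)

lemma sin_angle: "c < n \<Longrightarrow> sin (angle x c) = sqrt (ones x c) / sqrt (2 * real m)"
  and cos_angle: "c < n \<Longrightarrow> cos (angle x c) = sqrt (2 * real m - ones x c) / sqrt (2 * real m)"
proof -
  assume c: "c < n"
  have le: "real (ones x c) \<le> 2 * real m" using ones_le[OF c, of x] by simp
  have 1: "sqrt (ones x c / (2 * m)) \<le> 1" "- 1 \<le> sqrt (ones x c / (2 * m))"
    using le m by (auto intro: order_trans[OF _ real_sqrt_ge_zero])
  show "sin (angle x c) = sqrt (ones x c) / sqrt (2 * real m)"
    unfolding angle_def using 1 by (simp add: real_sqrt_divide)
  have "cos (angle x c) = sqrt (1 - ones x c / (2 * m))"
    unfolding angle_def using 1 by (simp add: cos_arcsin)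
  also have "1 - ones x c / (2 * m) = (2 * real m - ones x c) / (2 * real m)"
    using m by (simp add: field_simps)
  finally show "cos (angle x c) = sqrt (2 * real m - ones x c) / sqrt (2 * real m)"
    by (simp add: real_sqrt_divide)
qed

text \<open>Every position occurs as the entry itself and as its dummy copy, which is never
  marked.\<close>

lemma block_sum_split:
  assumes "c < n"
  shows "(\<Sum>j\<in>B c. (if x ! j then p else u) + u) = real (ones x c) * p + (2 * real m - ones x c) * u"
proof -
  have "(\<Sum>j\<in>B c. (if x ! j then p else u) + u) = (\<Sum>j\<in>B c. (if x ! j then p - u else 0) + 2 * u)"
    by (intro sum.cong) auto
  also have "\<dots> = real (ones x c) * (p - u) + 2 * real m * u"
    using finite_block[OF assms] card_block[OF assms]
    by (simp add: sum.distrib sum.inter_filter[symmetric] ones_def)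
  finally show ?thesis by (simp add: algebra_simps)
qed

lemma sum_records_block:
  assumes c: "c < n" and g: "\<And>j b r d. j < N \<Longrightarrow> r < M \<Longrightarrow>
    g (j, b, r, d) = (if b \<or> j \<notin> B c then 0 else if x ! j \<and> \<not> d then p r else u r)"
  shows "(\<Sum>v\<in>records N M. g v) = (\<Sum>r<M. real (ones x c) * p r + (2 * real m - ones x c) * u r)"
proof -
  have "(\<Sum>v\<in>records N M. g v) = (\<Sum>r<M. \<Sum>j<N. if j \<in> B c then (if x ! j then p r else u r) + u r else 0)"
    unfolding sum_records by (intro sum.cong) (auto simp: g)
  also have "\<dots> = (\<Sum>r<M. \<Sum>j\<in>B c. (if x ! j then p r else u r) + u r)"
    using block_subset[OF c] by (intro sum.cong sum.mono_neutral_cong_right) auto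
  finally show ?thesis by (simp add: block_sum_split[OF c])
qed

text \<open>One Grover step turns the angle \<open>A\<close> into \<open>A + 2 * \<theta>\<close>.
  After the phase the entries are those on the left, up to the added term; the third identity is
  their sum, and reflecting in the uniform vector adds
  \<open>2 * cos (A + \<theta>) / sqrt (2 * m)\<close> to each.\<close>

lemma search_amp_step:
  fixes x c i
  defines "\<theta> \<equiv> angle x c" and "k \<equiv> real (ones x c)"
  assumes c: "c < n"
  defines "A \<equiv> (2 * real i + 1) * \<theta>"
  shows "k > 0 \<Longrightarrow> sin A / sqrt k + 2 * cos (A + \<theta>) / sqrt (2 * real m)
      = sin ((2 * real (Suc i) + 1) * \<theta>) / sqrt k" (is "_ \<Longrightarrow> ?S")
    and "- (cos A / sqrt (2 * real m - k)) + 2 * cos (A + \<theta>) / sqrt (2 * real m)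
      = cos ((2 * real (Suc i) + 1) * \<theta>) / sqrt (2 * real m - k)" (is ?C)
    and "k * (sin A / sqrt k) - (2 * real m - k) * (cos A / sqrt (2 * real m - k))
      = - cos (A + \<theta>) * sqrt (2 * real m)" (is ?I)
proof -
  have k: "0 \<le> k" "k \<le> real m" using ones_le[OF c] by (auto simp: k_def)
  have mk: "0 < 2 * real m - k" using k m by linarith
  have s: "sin \<theta> = sqrt k / sqrt (2 * real m)" and co: "cos \<theta> = sqrt (2 * real m - k) / sqrt (2 * real m)"
    unfolding \<theta>_def k_def by (rule sin_angle[OF c], rule cos_angle[OF c])
  have A2: "(2 * real (Suc i) + 1) * \<theta> = (A + \<theta>) + \<theta>" by (simp add: A_def algebra_simps)
  have S: "sin ((A + \<theta>) + \<theta>) = sin A + 2 * cos (A + \<theta>) * sin \<theta>"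
    using sin_diff[of "A + \<theta>" \<theta>] sin_add[of "A + \<theta>" \<theta>] by simp
  have C: "cos ((A + \<theta>) + \<theta>) = - cos A + 2 * cos (A + \<theta>) * cos \<theta>"
    using cos_diff[of "A + \<theta>" \<theta>] cos_add[of "A + \<theta>" \<theta>] by simp
  show ?S if "k > 0"
    unfolding A2 S s using that by (simp add: add_divide_distrib)
  show ?C unfolding A2 C co using mk by (simp add: add_divide_distrib diff_divide_distrib)
  have "cos (A + \<theta>) = (cos A * sqrt (2 * real m - k) - sin A * sqrt k) / sqrt (2 * real m)"
    unfolding cos_add s co by (simp add: diff_divide_distrib)
  then have "- cos (A + \<theta>) * sqrt (2 * real m) = sin A * sqrt k - cos A * sqrt (2 * real m - k)"
    using m by simp
  also have "\<dots> = sin A * (k / sqrt k) - cos A * ((2 * real m - k) / sqrt (2 * real m - k))"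
    using k mk by (simp only: real_div_sqrt less_imp_le)
  also have "\<dots> = k * (sin A / sqrt k) - (2 * real m - k) * (cos A / sqrt (2 * real m - k))"
    by (simp add: mult.commute)
  finally show ?I by simp
qed

text \<open>At the angle \<theta> itself the two kinds of amplitude coincide. The start state is
  thus uniform and can be prepared without knowing the input.\<close>

lemma search_amp_zero:
  assumes c: "c < n"
  shows "search_amp 0 x c (j, b, r, d) = (if b \<or> j \<notin> B c then 0 else 1 / sqrt (2 * real m * M))"
proof -
  have mk: "sqrt (2 * real m - ones x c) > 0"
    using ones_le[OF c, of x] m by simp
  have k: "sqrt (ones x c) > 0" if "x ! j" "j \<in> B c"
    using that ones_pos_iff[OF c, of x] by auto
  show ?thesis
    using mk k by (auto simp: search_amp_def sin_angle[OF c] cos_angle[OF c] real_sqrt_mult)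
qed

lemma search_success:
  assumes c: "c < n" and one: "\<exists>j\<in>B c. x ! j"
  shows "(\<Sum>r<M. (sin ((2 * real r + 1) * angle x c))\<^sup>2) / real M \<ge> 1 / 4"
proof (rule average_sin_sq_ge[OF M_pos])
  define k where "k = real (ones x c)"
  have k: "1 \<le> k" "k \<le> real m"
    using ones_pos_iff[OF c, of x] one ones_le[OF c, of x] by (auto simp: k_def)
  \<comment> \<open>The dummy copy pays off here: \<open>2 * m - k\<close> is at least
    \<open>m\<close> even in a block full of 1s.\<close>
  have "1 * real m \<le> k * (2 * real m - k)" using k by (intro mult_mono) auto
  then have "sqrt (real m) \<le> sqrt (k * (2 * real m - k))" by simp
  moreover have "sin (2 * angle x c)
      = 2 * (sqrt k * sqrt (2 * real m - k)) / (sqrt (2 * real m) * sqrt (2 * real m))"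
    by (simp add: sin_double sin_angle[OF c] cos_angle[OF c] k_def)
  then have "sin (2 * angle x c) = sqrt (k * (2 * real m - k)) / real m"
    unfolding real_sqrt_mult_self using m by (simp add: real_sqrt_mult)
  ultimately have "sin (2 * angle x c) \<ge> sqrt (real m) / real m"
    by (simp add: divide_right_mono)
  moreover have "sqrt (real m) / real m \<ge> 1 / real M"
  proof -
    have "real m \<le> (real M)\<^sup>2" using M_sq by (metis of_nat_le_iff of_nat_power)
    then have "sqrt (real m) \<le> real M" by (intro real_le_lsqrt) auto
    then have "1 / real M \<le> 1 / sqrt (real m)" using m M_pos by (intro divide_left_mono) auto
    also have "1 / sqrt (real m) = sqrt (real m) / real m"
    proof -
      have "sqrt (real m) * sqrt (real m) = real m" by (simp only: real_sqrt_mult_self abs_of_nat)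
      then show ?thesis using m by (simp add: frac_eq_eq)
    qed
    finally show ?thesis .
  qed
  ultimately show "sin (2 * angle x c) \<ge> 1 / real M" by linarith
qed

definition marked :: "qrec \<Rightarrow> bool" where
  "marked = (\<lambda>(j, b, r, d). b \<and> \<not> d)"

text \<open>As \<open>r < M\<close>, all components have stopped after \<open>M - 1\<close> steps.
  One more query writes the answer bit.\<close>

definition found_amp :: "bool list \<Rightarrow> nat \<Rightarrow> qrec \<Rightarrow> real" where
  "found_amp x c v = search_amp (M - 1) x c (answer_flip x v)"

lemma found_amp_nonzero:
  assumes "found_amp x c (j, b, r, d) \<noteq> 0"
  shows "j \<in> B c" "b \<longleftrightarrow> x ! j"
  using assms by (auto simp: found_amp_def search_amp_def split: if_splits)

text \<open>A marked record has as its probability the average of the squared sines; weighting it by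
  \<open>s\<close> therefore removes the fraction \<open>1 - s\<close> of that.\<close>

lemma sum_found_amp:
  assumes c: "c < n"
  shows "(\<Sum>v\<in>records N M. (found_amp x c v)\<^sup>2 * (if marked v then s else 1))
    \<le> 1 - (1 - s) * ((\<Sum>r<M. (sin ((2 * real r + 1) * angle x c))\<^sup>2) / real M)"
proof -
  let ?s = "\<lambda>r. sin ((2 * real r + 1) * angle x c)"
  let ?c = "\<lambda>r. cos ((2 * real r + 1) * angle x c)"
  let ?k = "real (ones x c)"
  have mk: "2 * real m - ?k > 0" using ones_le[OF c, of x] m by simp
  have flip: "(\<Sum>v\<in>records N M. g (answer_flip x v)) = (\<Sum>v\<in>records N M. g v)" for g :: "qrec \<Rightarrow> real"
    by (rule sum.reindex_bij_witness[where i = "answer_flip x" and j = "answer_flip x"])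
       (auto simp: records_def)
  have "(\<Sum>v\<in>records N M. (found_amp x c v)\<^sup>2 * (if marked v then s else 1))
      = (\<Sum>v\<in>records N M. (found_amp x c (answer_flip x v))\<^sup>2 * (if marked (answer_flip x v) then s else 1))"
    by (rule flip[symmetric])
  also have "\<dots> = (\<Sum>r<M. ?k * ((?s r)\<^sup>2 / ?k / M * s) + (2 * real m - ?k) * ((?c r)\<^sup>2 / (2 * real m - ?k) / M))"
  proof (rule sum_records_block[OF c])
    fix j b r d assume r: "r < M"
    then have "min (M - 1) r = r" by auto
    then show "(found_amp x c (answer_flip x (j, b, r, d)))\<^sup>2 *
        (if marked (answer_flip x (j, b, r, d)) then s else 1) =
        (if b \<or> j \<notin> B c then 0 else if x ! j \<and> \<not> d then (?s r)\<^sup>2 / ?k / M * s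
         else (?c r)\<^sup>2 / (2 * real m - ?k) / M)"
      using mk by (auto simp: found_amp_def search_amp_def marked_def power_divide)
  qed
  also have "\<dots> \<le> (\<Sum>r<M. ((?s r)\<^sup>2 * s + (?c r)\<^sup>2) / M)"
  proof (rule sum_mono)
    fix r
    have "?k * ((?s r)\<^sup>2 / ?k / M * s) = (?s r)\<^sup>2 * s / M"
      \<comment> \<open>In a zero block the angle is 0, so the sine vanishes along with the
        divisor.\<close>
      by (cases "ones x c = 0") (simp_all add: angle_def)
    then show "?k * ((?s r)\<^sup>2 / ?k / M * s) + (2 * real m - ?k) * ((?c r)\<^sup>2 / (2 * real m - ?k) / M)
        \<le> ((?s r)\<^sup>2 * s + (?c r)\<^sup>2) / M"
      using mk by (simp add: add_divide_distrib)
  qed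
  also have "\<dots> = (\<Sum>r<M. 1 / M - (1 - s) * ((?s r)\<^sup>2 / M))"
    by (intro sum.cong) (auto simp: cos_squared_eq field_simps)
  also have "\<dots> = 1 - (1 - s) * ((\<Sum>r<M. (?s r)\<^sup>2) / M)"
    using M_pos by (simp add: sum_subtractf sum_distrib_left[symmetric] sum_divide_distrib[symmetric])
  finally show ?thesis .
qed

end

section \<open>Success probability of the adaptive search\<close>

context block_search
begin

definition found :: "qrec list \<Rightarrow> nat" where
  "found g = length (filter marked g)"

text \<open>Each marked record closes one block and opens the next, so the number of marks is the
  index of the block. Once all are closed, the default 0 keeps the remaining runs on a valid
  block.\<close>

definition current :: "qrec list \<Rightarrow> nat" where
  "current g = (if found g < n then found g else 0)"

definition rounds :: nat where
  "rounds = 8 * n"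

text \<open>The checked block is frozen at the end of the search by \<open>take rounds\<close>: a
  check record with answer 1 also counts as \<open>marked\<close> and would otherwise move
  \<open>current\<close> on.\<close>

definition checked :: "qrec list \<Rightarrow> nat" where
  "checked g = sorted_list_of_set (B (current (take rounds g))) ! (length g - rounds)"

definition step_amp :: "bool list \<Rightarrow> qrec list \<Rightarrow> qrec \<Rightarrow> real" where
  "step_amp x g v = (if length g < rounds then found_amp x (current g) v
     else of_bool (v = (checked g, x ! checked g, 0, False)))"

text \<open>The chain rule for histories: every factor is the amplitude of a record conditioned on
  the earlier ones.\<close>

definition amp :: "bool list \<Rightarrow> qrec list \<Rightarrow> real" where
  "amp x g = (\<Prod>i<length g. step_amp x (take i g) (g ! i))"

lemma current_less: "current g < n"
  using n by (simp add: current_def)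

lemma found_snoc: "found (g @ [v]) = found g + of_bool (marked v)"
  by (simp add: found_def)

lemma amp_Nil [simp]: "amp x [] = 1"
  by (simp add: amp_def)

lemma amp_snoc: "amp x (g @ [v]) = amp x g * step_amp x g v"
  by (simp add: amp_def nth_append)

lemma amp_nonzeroD:
  assumes "amp x g \<noteq> 0" "i < length g"
  shows "step_amp x (take i g) (g ! i) \<noteq> 0"
  using assms by (simp add: amp_def)

lemma checked_less:
  assumes "rounds \<le> length g" "length g < rounds + m"
  shows "checked g < N"
proof -
  let ?c = "current (take rounds g)"
  have "length (sorted_list_of_set (B ?c)) = m" "set (sorted_list_of_set (B ?c)) = B ?c"
    using current_less finite_block card_block by auto
  then have "checked g \<in> B ?c"
    unfolding checked_def using assms by (metis nth_mem less_diff_conv2 add.commute)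
  then show ?thesis using block_subset[OF current_less] by auto
qed

lemma ex_checked:
  assumes "j \<in> B (current (take rounds h))" "length h = rounds + m"
  obtains i where "rounds \<le> i" "i < rounds + m" "checked (take i h) = j"
proof -
  let ?c = "current (take rounds h)"
  have "length (sorted_list_of_set (B ?c)) = m" "set (sorted_list_of_set (B ?c)) = B ?c"
    using current_less finite_block card_block by auto
  then obtain s where s: "s < m" "sorted_list_of_set (B ?c) ! s = j"
    using assms(1) by (metis in_set_conv_nth)
  have "checked (take (rounds + s) h) = j"
    unfolding checked_def using assms(2) s by (simp add: min_def)
  then show thesis using s(1) by (intro that) auto
qed

lemma amp_checkedD:
  assumes "amp x h \<noteq> 0" "rounds \<le> i" "i < length h"
  shows "h ! i = (checked (take i h), x ! checked (take i h), 0, False)"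
  using amp_nonzeroD[OF assms(1,3)] assms(2,3) by (auto simp: step_amp_def split: if_splits)

text \<open>A marked record shows a genuine 1 of the current block, so the count cannot move past a
  zero block.\<close>

lemma found_le_zero_block:
  assumes amp: "amp x h \<noteq> 0" and b: "b < n" and zero: "\<forall>j\<in>B b. \<not> x ! j"
    and "i \<le> rounds" "i \<le> length h"
  shows "found (take i h) \<le> b"
  using assms(4,5)
proof (induction i)
  case (Suc i)
  have IH: "found (take i h) \<le> b" using Suc by simp
  have take: "take (Suc i) h = take i h @ [h ! i]"
    using Suc.prems by (simp add: take_Suc_conv_app_nth)
  obtain j bb r d where hi: "h ! i = (j, bb, r, d)" by (metis prod.exhaust)
  have "found_amp x (current (take i h)) (j, bb, r, d) \<noteq> 0"
    using amp_nonzeroD[OF amp, of i] Suc.prems by (auto simp: step_amp_def hi)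
  note nz = found_amp_nonzero[OF this]
  have "\<not> marked (h ! i)" if "found (take i h) = b"
    using nz zero that b by (auto simp: marked_def hi current_def)
  then show ?case using IH unfolding take found_snoc by (cases "found (take i h) = b") auto
qed (simp add: found_def)

section \<open>Expectations over the random history\<close>

definition prob_sum :: "bool list \<Rightarrow> nat \<Rightarrow> (qrec list \<Rightarrow> real) \<Rightarrow> real" where
  "prob_sum x t G = (\<Sum>h\<in>histories N M t. (amp x h)\<^sup>2 * G h)"

text \<open>The tower rule: a bound on the conditional expectation given \<open>g\<close> carries
  over to the whole expectation.\<close>

lemma prob_sum_step:
  assumes "\<And>g. g \<in> histories N M t \<Longrightarrow> (\<Sum>v\<in>records N M. (step_amp x g v)\<^sup>2 * G' (g @ [v])) \<le> \<rho> * G g"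
  shows "prob_sum x (Suc t) G' \<le> \<rho> * prob_sum x t G"
proof -
  have "prob_sum x (Suc t) G' = (\<Sum>(g, v)\<in>histories N M t \<times> records N M. (amp x (g @ [v]))\<^sup>2 * G' (g @ [v]))"
    unfolding prob_sum_def
  proof (rule sum.reindex_bij_witness[where i = "\<lambda>(g, v). g @ [v]" and j = "\<lambda>h. (butlast h, last h)"])
    fix h assume h: "h \<in> histories N M (Suc t)"
    then have ne: "h \<noteq> []" by (auto simp: histories_def)
    then have h': "h = butlast h @ [last h]" by simp
    have "set h = insert (last h) (set (butlast h))"
      by (subst h') (simp del: append_butlast_last_id)
    then show "(butlast h, last h) \<in> histories N M t \<times> records N M"
      using h by (auto simp: histories_def)
    show "(case (butlast h, last h) of (g, v) \<Rightarrow> g @ [v]) = h" using ne by simp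
    show "(case (butlast h, last h) of (g, v) \<Rightarrow> (amp x (g @ [v]))\<^sup>2 * G' (g @ [v])) = (amp x h)\<^sup>2 * G' h"
      using ne by simp
  qed (auto simp: histories_def)
  also have "\<dots> = (\<Sum>g\<in>histories N M t. (amp x g)\<^sup>2 * (\<Sum>v\<in>records N M. (step_amp x g v)\<^sup>2 * G' (g @ [v])))"
    by (simp add: sum.cartesian_product[symmetric] amp_snoc power_mult_distrib sum_distrib_left mult.assoc)
  also have "\<dots> \<le> (\<Sum>g\<in>histories N M t. (amp x g)\<^sup>2 * (\<rho> * G g))"
    by (intro sum_mono mult_left_mono assms) auto
  also have "\<dots> = \<rho> * prob_sum x t G"
    by (simp add: prob_sum_def sum_distrib_left mult_ac)
  finally show ?thesis .
qed

text \<open>The sentinel \<open>n\<close> stands for the absence of a zero block; only blocks before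
  this index can be closed by the search.\<close>

definition first_zero :: "bool list \<Rightarrow> nat" where
  "first_zero x = (LEAST c. c = n \<or> (\<forall>j\<in>B c. \<not> x ! j))"

lemma first_zero_le: "first_zero x \<le> n"
  unfolding first_zero_def by (rule Least_le) simp

lemma first_zero: "first_zero x = n \<or> (\<forall>j\<in>B (first_zero x). \<not> x ! j)"
  unfolding first_zero_def by (rule LeastI[of _ n]) simp

lemma less_first_zero: "c < first_zero x \<Longrightarrow> \<exists>j\<in>B c. x ! j"
  unfolding first_zero_def using not_less_Least by blast

text \<open>A round on a nonzero block marks a 1 with probability at least 1/4, so on average it shrinks
  the potential by the factor \<open>3/4 + 1/4 * 1/2\<close>.\<close>

definition potential :: "bool list \<Rightarrow> qrec list \<Rightarrow> real" where
  "potential x g = (if found g < first_zero x then 2 ^ (first_zero x - found g) else 0)"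

lemma potential_snoc:
  "potential x (g @ [v]) \<le> potential x g * (if marked v then 1 / 2 else 1)"
proof (cases "marked v \<and> found g + 1 < first_zero x")
  case True
  then have "first_zero x - found g = Suc (first_zero x - (found g + 1))"
    using True by arith
  then show ?thesis using True by (simp add: potential_def found_snoc)
qed (auto simp: potential_def found_snoc)

lemma potential_step:
  assumes "length g < rounds"
  shows "(\<Sum>v\<in>records N M. (step_amp x g v)\<^sup>2 * potential x (g @ [v])) \<le> 7 / 8 * potential x g"
proof (cases "found g < first_zero x")
  case True
  then have fn: "found g < n" using first_zero_le[of x] by simp
  then have cur: "current g = found g" by (simp add: current_def)
  let ?p = "(\<Sum>r<M. (sin ((2 * real r + 1) * angle x (found g)))\<^sup>2) / real M"
  have p: "?p \<ge> 1 / 4" by (rule search_success[OF fn less_first_zero[OF True]])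
  have pos: "potential x g \<ge> 0" by (simp add: potential_def)
  have "(\<Sum>v\<in>records N M. (step_amp x g v)\<^sup>2 * potential x (g @ [v]))
      \<le> (\<Sum>v\<in>records N M. (found_amp x (found g) v)\<^sup>2 * (potential x g * (if marked v then 1 / 2 else 1)))"
  proof (rule sum_mono)
    fix v
    have "step_amp x g v = found_amp x (found g) v" using assms by (simp add: step_amp_def cur)
    then show "(step_amp x g v)\<^sup>2 * potential x (g @ [v])
        \<le> (found_amp x (found g) v)\<^sup>2 * (potential x g * (if marked v then 1 / 2 else 1))"
      using potential_snoc by (simp only:) (intro mult_left_mono, auto)
  qed
  also have "\<dots> = potential x g * (\<Sum>v\<in>records N M. (found_amp x (found g) v)\<^sup>2 * (if marked v then 1 / 2 else 1))"
    unfolding sum_distrib_left by (intro sum.cong refl) (simp only: mult_ac)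
  also have "\<dots> \<le> potential x g * (1 - (1 - 1 / 2) * ?p)"
    by (intro mult_left_mono sum_found_amp fn pos)
  also have "\<dots> \<le> potential x g * (7 / 8)"
  proof (intro mult_left_mono pos)
    have "1 - (1 - 1 / 2) * q \<le> 7 / 8" if "1 / 4 \<le> q" for q :: real using that by simp
    then show "1 - (1 - 1 / 2) * ?p \<le> 7 / 8" using p by blast
  qed
  finally show ?thesis by (simp add: mult.commute)
next
  case False
  then show ?thesis by (auto simp: potential_def found_snoc)
qed

lemma prob_sum_potential_rounds:
  "t \<le> rounds \<Longrightarrow> prob_sum x t (potential x) \<le> (7 / 8) ^ t * 2 ^ n"
proof (induction t)
  case 0
  have "histories N M 0 = {[]}" by (auto simp: histories_def)
  moreover have "potential x [] \<le> 2 ^ n"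
    using first_zero_le[of x] by (auto simp: potential_def found_def intro: power_increasing)
  ultimately show ?case by (simp add: prob_sum_def)
next
  case (Suc t)
  have "prob_sum x (Suc t) (potential x) \<le> 7 / 8 * prob_sum x t (potential x)"
    by (rule prob_sum_step[OF potential_step]) (use Suc.prems in \<open>auto simp: histories_def\<close>)
  also have "\<dots> \<le> 7 / 8 * ((7 / 8) ^ t * 2 ^ n)" using Suc by (intro mult_left_mono) auto
  finally show ?case by simp
qed

text \<open>After \<open>8 * n\<close> rounds the decay outweighs the initial \<open>2 ^ n\<close>.
  The checks are deterministic given the history, and the potential ignores their records.\<close>

lemma prob_sum_potential:
  "prob_sum x (rounds + s) (\<lambda>h. potential x (take rounds h)) \<le> 1"
proof (induction s)
  case 0
  have "prob_sum x rounds (\<lambda>h. potential x (take rounds h)) = prob_sum x rounds (potential x)"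
    unfolding prob_sum_def by (intro sum.cong) (auto simp: histories_def)
  also have "\<dots> \<le> (7 / 8) ^ rounds * 2 ^ n" by (rule prob_sum_potential_rounds) simp
  also have "\<dots> = ((7 / 8) ^ 8 * 2) ^ n"
    by (simp only: rounds_def power_mult power_mult_distrib)
  also have "\<dots> \<le> 1" by (rule power_le_one) (simp_all add: power_divide)
  finally show ?case by simp
next
  case (Suc s)
  have "prob_sum x (Suc (rounds + s)) (\<lambda>h. potential x (take rounds h))
      \<le> 1 * prob_sum x (rounds + s) (\<lambda>h. potential x (take rounds h))"
  proof (rule prob_sum_step)
    fix g assume g: "g \<in> histories N M (rounds + s)"
    let ?v = "(checked g, x ! checked g, 0, False)"
    have len: "length g = rounds + s" using g by (simp add: histories_def)
    have "(\<Sum>v\<in>records N M. (step_amp x g v)\<^sup>2 * potential x (take rounds (g @ [v])))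
        = (\<Sum>v\<in>records N M. if v = ?v then potential x (take rounds g) else 0)"
      by (intro sum.cong) (auto simp: step_amp_def len)
    also have "\<dots> \<le> potential x (take rounds g)"
      using finite_records by (simp add: potential_def)
    finally show "(\<Sum>v\<in>records N M. (step_amp x g v)\<^sup>2 * potential x (take rounds (g @ [v])))
        \<le> 1 * potential x (take rounds g)" by simp
  qed
  then show ?case using Suc by simp
qed

definition verdict :: "qrec list \<Rightarrow> bool option" where
  "verdict h = (if n \<le> found (take rounds h) then Some True
     else if \<forall>i. rounds \<le> i \<and> i < length h \<longrightarrow> \<not> fst (snd (h ! i)) then Some False else None)"

text \<open>A zero block prevents \<open>n\<close> marks. If there is none, checking all of any
  block meets a 1 and blocks the answer 0.\<close>

lemma verdict_correct:
  assumes amp: "amp x h \<noteq> 0" and len: "length h = rounds + m"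
  shows "verdict h \<noteq> Some (\<not> and_of_ors n B x)"
proof (cases "and_of_ors n B x")
  case False
  then obtain b where b: "b < n" "\<forall>j\<in>B b. \<not> x ! j" by (auto simp: and_of_ors_def)
  have "found (take rounds h) \<le> b"
    by (rule found_le_zero_block[OF amp b]) (simp_all add: len)
  then show ?thesis using b False by (simp add: verdict_def)
next
  case True
  obtain j where j: "j \<in> B (current (take rounds h))" "x ! j"
    using True current_less unfolding and_of_ors_def by blast
  obtain i where i: "rounds \<le> i" "i < rounds + m" "checked (take i h) = j"
    using ex_checked[OF j(1) len] .
  have "fst (snd (h ! i))"
    using amp_checkedD[OF amp i(1)] i j(2) len by simp
  then show ?thesis using True i len by (auto simp: verdict_def)
qed

text \<open>Without a verdict, the search has stopped in a block where the check found a 1. This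
  block precedes the first zero block, so at least one factor 2 remains.\<close>

lemma verdict_None:
  assumes amp: "amp x h \<noteq> 0" and len: "length h = rounds + m" and none: "verdict h = None"
  shows "potential x (take rounds h) \<ge> 2"
proof -
  let ?c = "found (take rounds h)"
  have c: "?c < n" using none by (auto simp: verdict_def split: if_splits)
  obtain i where i: "rounds \<le> i" "i < length h" "fst (snd (h ! i))"
    using none by (auto simp: verdict_def split: if_splits)
  have "x ! checked (take i h)" using amp_checkedD[OF amp i(1,2)] i(3) by simp
  moreover have "checked (take i h) \<in> B ?c"
  proof -
    have "length (sorted_list_of_set (B ?c)) = m" "set (sorted_list_of_set (B ?c)) = B ?c"
      using c finite_block card_block by auto
    moreover have "checked (take i h) = sorted_list_of_set (B ?c) ! (i - rounds)"
      using c i(1,2) by (simp add: checked_def current_def min_def)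
    ultimately show ?thesis using i(1,2) len by (metis nth_mem less_diff_conv2 add.commute)
  qed
  ultimately have one: "\<exists>j\<in>B ?c. x ! j" by blast
  have "?c < first_zero x"
  proof (rule ccontr)
    assume "\<not> ?c < first_zero x"
    then have z: "first_zero x < n" "\<forall>j\<in>B (first_zero x). \<not> x ! j"
      using c first_zero[of x] by auto
    have "?c \<le> first_zero x"
      by (rule found_le_zero_block[OF amp z]) (simp_all add: len)
    then show False using \<open>\<not> ?c < first_zero x\<close> z one by (metis le_antisym not_less)
  qed
  then show ?thesis
    using power_increasing[of 1 "first_zero x - ?c" "2 :: real"] by (simp add: potential_def)
qed

end

section \<open>Implementation of the adaptive search\<close>

locale block_search_algorithm = block_search N n m M B + record_algorithm N M "8 * n + m" W idx
  for N n m M :: nat and B :: "nat \<Rightarrow> nat set" and W :: nat and idx :: "qrec \<times> qrec list \<Rightarrow> nat"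
begin

text \<open>The Householder reflection along \<open>rec0 - u\<close> exchanges the blank record with
  the uniform unit vector \<open>u\<close>; the squared length of \<open>rec0 - u\<close> is
  \<open>2 - 2 * u rec0\<close>.\<close>

lemma reachable_prepare:
  assumes "reachable T (\<lambda>x (v, h). of_bool (v = rec0) * A x h)" and C: "\<And>h. C h < n"
  shows "reachable T (\<lambda>x (v, h). A x h * search_amp 0 x (C h) v)"
proof -
  define u :: "nat \<Rightarrow> qrec \<Rightarrow> real" where
    "u c = (\<lambda>(j, b, r, d). if b \<or> j \<notin> B c then 0 else 1 / sqrt (2 * real m * M))" for c
  have u: "search_amp 0 x (C h) v = u (C h) v" for x h v
    by (cases v) (simp add: search_amp_zero[OF C] u_def)
  have mM: "1 < 2 * real m * M"
  proof -
    have "1 * 1 \<le> real m * real M" using m M_pos by (intro mult_mono) auto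
    then show ?thesis by simp
  qed
  \<comment> \<open>The two vectors differ, so their difference can be normalised.\<close>
  have u0: "u c rec0 < 1" for c
  proof -
    have "1 < sqrt (2 * real m * M)" using mM by (simp only: real_sqrt_gt_1_iff)
    then have "1 / sqrt (2 * real m * M) < 1" by (simp only: divide_less_eq_1_pos)
    then show ?thesis by (simp add: u_def rec0_def)
  qed
  have norm_u: "(\<Sum>v\<in>V. (u (C h) v)\<^sup>2) = 1" for h
  proof -
    \<comment> \<open>A dummy input: \<open>u\<close> ignores it, and it only splits the block for
      \<open>sum_records_block\<close>.\<close>
    define x :: "bool list" where "x = []"
    have "(\<Sum>v\<in>V. (u (C h) v)\<^sup>2) = (\<Sum>r<M. real (ones x (C h)) * (1 / (2 * real m * M))
        + (2 * real m - ones x (C h)) * (1 / (2 * real m * M)))"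
      by (rule sum_records_block[OF C]) (auto simp: u_def power_divide)
    also have "\<dots> = (\<Sum>r<M. 1 / M)"
      using m by (intro sum.cong refl) (simp add: add_divide_distrib[symmetric])
    finally show ?thesis using M_pos by simp
  qed
  define a where "a h v = (of_bool (v = rec0) - u (C h) v) / sqrt (2 - 2 * u (C h) rec0)" for h :: "qrec list" and v
  have delta: "(\<Sum>v\<in>V. of_bool (v = rec0) * g v) = g rec0" for g :: "qrec \<Rightarrow> real"
  proof -
    have "(\<Sum>v\<in>V. of_bool (v = rec0) * g v) = (\<Sum>v\<in>V. if v = rec0 then g v else 0)"
      by (intro sum.cong) auto
    then show ?thesis using finite_records rec0_in_records[OF N M] by simp
  qed
  have norm_a: "(\<Sum>v\<in>V. of_bool (() = ()) * (a h v)\<^sup>2) = 1" for h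
  proof -
    have "(\<Sum>v\<in>V. of_bool (() = ()) * (a h v)\<^sup>2) = (\<Sum>v\<in>V. of_bool (v = rec0) * (1 - 2 * u (C h) v)
        + (u (C h) v)\<^sup>2) / (2 - 2 * u (C h) rec0)"
      unfolding sum_divide_distrib a_def using u0[of "C h"]
      by (intro sum.cong refl) (auto simp: power_divide power2_diff diff_add_eq add.commute)
    then show ?thesis
      using u0[of "C h"] by (simp add: sum.distrib delta norm_u)
  qed
  have "reachable T (\<lambda>x (v, h). of_bool (v = rec0) * A x h
      - 2 * a h v * (\<Sum>w\<in>V. of_bool (() = ()) * (a h w * (of_bool (w = rec0) * A x h))))"
    by (rule reachable_reflection[OF assms(1) norm_a])
  then show ?thesis
  proof (rule reachable_cong)
    fix x :: "bool list" and k :: "qrec \<times> qrec list"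
    obtain v h where k: "k = (v, h)" by (cases k)
    let ?u = "u (C h)"
    have pos: "0 < 2 - 2 * ?u rec0" using u0[of "C h"] by simp
    have "(\<Sum>w\<in>V. of_bool (() = ()) * (a h w * (of_bool (w = rec0) * A x h)))
        = (\<Sum>w\<in>V. of_bool (w = rec0) * (a h w * A x h))"
      by (intro sum.cong) auto
    also have "\<dots> = a h rec0 * A x h" by (rule delta)
    finally have s: "(\<Sum>w\<in>V. of_bool (() = ()) * (a h w * (of_bool (w = rec0) * A x h))) = a h rec0 * A x h" .
    have "2 * a h v * a h rec0 = (of_bool (v = rec0) - ?u v) * (2 - 2 * ?u rec0)
        / (sqrt (2 - 2 * ?u rec0) * sqrt (2 - 2 * ?u rec0))"
      by (simp add: a_def algebra_simps)
    also have "sqrt (2 - 2 * ?u rec0) * sqrt (2 - 2 * ?u rec0) = 2 - 2 * ?u rec0"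
      using pos by simp
    also have "(of_bool (v = rec0) - ?u v) * (2 - 2 * ?u rec0) / (2 - 2 * ?u rec0) = of_bool (v = rec0) - ?u v"
      using pos by simp
    finally have t: "2 * a h v * a h rec0 = of_bool (v = rec0) - ?u v" .
    have "of_bool (v = rec0) * A x h - 2 * a h v * (a h rec0 * A x h)
        = (of_bool (v = rec0) - 2 * a h v * a h rec0) * A x h"
      by (simp add: algebra_simps)
    then show "(case k of (v, h) \<Rightarrow> of_bool (v = rec0) * A x h
        - 2 * a h v * (\<Sum>w\<in>V. of_bool (() = ()) * (a h w * (of_bool (w = rec0) * A x h))))
        = (case k of (v, h) \<Rightarrow> A x h * search_amp 0 x (C h) v)"
      unfolding k prod.case s u t by simp
  qed
qed

text \<open>The phase flips the sign of the unmarked entries rather than of the marked ones; together with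
  the reflection \<open>1 - 2uu\<^sup>T\<close> this is the usual Grover step, without a global sign.\<close>

lemma reachable_iterate:
  assumes "reachable T (\<lambda>x (v, h). A x h * search_amp i x (C h) v)" and C: "\<And>h. C h < n"
  shows "reachable (T + 2) (\<lambda>x (v, h). A x h * search_amp (Suc i) x (C h) v)"
proof -
  \<comment> \<open>The condition \<open>i < r\<close> freezes the components that have done their
    \<open>r\<close> steps. Using \<open>r\<close> as the key \<kappa> lets the reflection act on
    each component separately.\<close>
  define P :: "qrec list \<Rightarrow> qrec \<Rightarrow> bool" where "P h = (\<lambda>(j, b, r, d). i < r \<and> \<not> (b \<and> \<not> d))" for h
  define \<kappa> :: "qrec \<Rightarrow> nat" where "\<kappa> = (\<lambda>(j, b, r, d). r)"
  define a :: "qrec list \<Rightarrow> qrec \<Rightarrow> real" where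
    "a h = (\<lambda>(j, b, r, d). if b \<or> j \<notin> B (C h) \<or> r \<le> i then 0 else 1 / sqrt (2 * real m))" for h
  define \<phi> where "\<phi> x h v = (if P h (answer_flip x v) then - (A x h * search_amp i x (C h) v)
      else A x h * search_amp i x (C h) v)" for x h v
  have flip2: "answer_flip x (answer_flip x v) = v" for x v
    by (cases v) auto
  have "reachable (Suc T) (\<lambda>x (v, h). A x h * search_amp i x (C h) (answer_flip x v))"
    by (rule reachable_query_rec[OF assms(1)])
  then have "reachable (Suc T) (\<lambda>x (v, h). (if P h v then - (A x h * search_amp i x (C h) (answer_flip x v))
      else A x h * search_amp i x (C h) (answer_flip x v)))"
    by (rule reachable_phase)
  \<comment> \<open>The second query erases the answer that the first one wrote for the phase; hence
    two queries per step.\<close>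
  from reachable_query_rec[OF this]
  have "reachable (Suc (Suc T)) (\<lambda>x (v, h). \<phi> x h v)"
    by (rule reachable_cong) (simp add: flip2 \<phi>_def split_def)
  then have "reachable (T + 2) (\<lambda>x (v, h). \<phi> x h v)" by simp
  then have "reachable (T + 2) (\<lambda>x (v, h). \<phi> x h v
      - 2 * a h v * (\<Sum>w\<in>V. of_bool (\<kappa> v = \<kappa> w) * (a h w * \<phi> x h w)))"
  proof (rule reachable_reflection)
    fix h v assume v: "v \<in> V" and a: "a h v \<noteq> 0"
    define x :: "bool list" where "x = []"
    obtain j b r d where vv: "v = (j, b, r, d)" by (metis prod.exhaust)
    have r: "i < r" "r < M" using v a by (auto simp: vv a_def records_def split: if_splits)
    have "(\<Sum>w\<in>V. of_bool (\<kappa> v = \<kappa> w) * (a h w)\<^sup>2) = (\<Sum>r'<M. real (ones x (C h)) * (if r = r' then 1 / (2 * real m) else 0)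
        + (2 * real m - ones x (C h)) * (if r = r' then 1 / (2 * real m) else 0))"
      using r by (intro sum_records_block[OF C]) (auto simp: vv \<kappa>_def a_def power_divide)
    also have "\<dots> = (\<Sum>r'<M. if r = r' then 1 else 0)"
      using m by (intro sum.cong refl) (simp add: distrib_right[symmetric] add_divide_distrib[symmetric])
    finally show "(\<Sum>w\<in>V. of_bool (\<kappa> v = \<kappa> w) * (a h w)\<^sup>2) = 1" using r by simp
  qed
  then show ?thesis
  proof (rule reachable_cong)
    fix x :: "bool list" and k assume "k \<in> V \<times> H"
    then obtain j b r d h where k: "k = ((j, b, r, d), h)" and r: "r < M"
      by (auto simp: records_def)
    let ?v = "(j, b, r, d)"
    define \<theta> where "\<theta> = angle x (C h)"
    define X where "X = (2 * real i + 1) * \<theta>"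
    define kk where "kk = real (ones x (C h))"
    note step = search_amp_step[OF C[of h], where x = x and i = i, folded \<theta>_def kk_def, folded X_def]
    show "(case k of (v, h) \<Rightarrow> \<phi> x h v
        - 2 * a h v * (\<Sum>w\<in>V. of_bool (\<kappa> v = \<kappa> w) * (a h w * \<phi> x h w)))
        = (case k of (v, h) \<Rightarrow> A x h * search_amp (Suc i) x (C h) v)"
    proof (cases "b \<or> j \<notin> B (C h) \<or> r \<le> i")
      \<comment> \<open>Records with \<open>b\<close> set or \<open>j\<close> outside the block have
        amplitude 0. For \<open>r <= i\<close> neither gate acts, and
        \<open>min i r = min (Suc i) r\<close>.\<close>
      case True
      then have "a h ?v = 0" by (simp add: a_def)
      moreover have "\<phi> x h ?v = A x h * search_amp (Suc i) x (C h) ?v"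
        using True by (auto simp: \<phi>_def P_def search_amp_def min_def)
      ultimately show ?thesis by (simp add: k)
    next
      case False
      then have v: "\<not> b" "j \<in> B (C h)" "i < r" by auto
      have "(\<Sum>w\<in>V. of_bool (\<kappa> ?v = \<kappa> w) * (a h w * \<phi> x h w))
          = (\<Sum>r'<M. kk * (if r = r' then A x h * (sin X / sqrt kk) / sqrt M / sqrt (2 * real m) else 0)
            + (2 * real m - kk) * (if r = r' then - (A x h * (cos X / sqrt (2 * real m - kk)) / sqrt M / sqrt (2 * real m)) else 0))"
        unfolding kk_def
        by (rule sum_records_block[OF C])
           (use v in \<open>auto simp: \<kappa>_def a_def \<phi>_def P_def search_amp_def min_def X_def \<theta>_def\<close>)
      also have "\<dots> = (\<Sum>r'<M. if r = r' then A x h / sqrt M / sqrt (2 * real m) *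
          (kk * (sin X / sqrt kk) - (2 * real m - kk) * (cos X / sqrt (2 * real m - kk))) else 0)"
      proof (intro sum.cong refl)
        fix r' assume "r' \<in> {..<M}"
        have alg: "K * (e * s / y / z) + L * - (e * c / y / z) = e / y / z * (K * s - L * c)"
          for K L e s c y z :: real by (simp add: right_diff_distrib mult_ac)
        show "kk * (if r = r' then A x h * (sin X / sqrt kk) / sqrt M / sqrt (2 * real m) else 0)
            + (2 * real m - kk) * (if r = r' then - (A x h * (cos X / sqrt (2 * real m - kk)) / sqrt M / sqrt (2 * real m)) else 0)
            = (if r = r' then A x h / sqrt M / sqrt (2 * real m) *
              (kk * (sin X / sqrt kk) - (2 * real m - kk) * (cos X / sqrt (2 * real m - kk))) else 0)"
        proof (cases "r = r'")
          case True
          show ?thesis unfolding if_P[OF True] by (rule alg)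
        qed simp
      qed
      also have "\<dots> = A x h / sqrt M / sqrt (2 * real m) * (- cos (X + \<theta>) * sqrt (2 * real m))"
        unfolding step(3) using r by simp
      also have "\<dots> = - (A x h / sqrt M * cos (X + \<theta>))"
        using m by simp
      finally have s: "(\<Sum>w\<in>V. of_bool (\<kappa> ?v = \<kappa> w) * (a h w * \<phi> x h w)) = - (A x h / sqrt M * cos (X + \<theta>))" .
      have av: "a h ?v = 1 / sqrt (2 * real m)" using v by (simp add: a_def)
      have mins: "min i r = i" "min (Suc i) r = Suc i" using v by auto
      have "\<phi> x h ?v - 2 * a h ?v * - (A x h / sqrt M * cos (X + \<theta>)) = A x h * search_amp (Suc i) x (C h) ?v"
      proof (cases "x ! j \<and> \<not> d")
        case True
        then have "kk > 0" using ones_pos_iff[OF C[of h], of x] v(2) by (auto simp: kk_def)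
        have "\<phi> x h ?v = A x h / sqrt M * (sin X / sqrt kk)"
          using True v by (simp add: \<phi>_def P_def search_amp_def mins X_def \<theta>_def kk_def)
        then have "\<phi> x h ?v - 2 * a h ?v * - (A x h / sqrt M * cos (X + \<theta>))
            = A x h / sqrt M * (sin X / sqrt kk + 2 * cos (X + \<theta>) / sqrt (2 * real m))"
          unfolding av by (simp add: algebra_simps)
        also have "\<dots> = A x h * search_amp (Suc i) x (C h) ?v"
          unfolding step(1)[OF \<open>kk > 0\<close>]
          using True v by (simp add: search_amp_def mins \<theta>_def kk_def)
        finally show ?thesis .
      next
        case False
        have "\<phi> x h ?v = A x h / sqrt M * - (cos X / sqrt (2 * real m - kk))"
          using False v by (auto simp: \<phi>_def P_def search_amp_def mins X_def \<theta>_def kk_def)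
        then have "\<phi> x h ?v - 2 * a h ?v * - (A x h / sqrt M * cos (X + \<theta>))
            = A x h / sqrt M * (- (cos X / sqrt (2 * real m - kk)) + 2 * cos (X + \<theta>) / sqrt (2 * real m))"
          unfolding av by (simp add: algebra_simps)
        also have "\<dots> = A x h * search_amp (Suc i) x (C h) ?v"
          unfolding step(2)
          using False v by (auto simp: search_amp_def mins \<theta>_def kk_def)
        finally show ?thesis .
      qed
      then show ?thesis by (simp only: k prod.case s)
    qed
  qed
qed

lemma reachable_search:
  assumes "reachable T (\<lambda>x (v, h). of_bool (v = rec0) * A x h)" and C: "\<And>h. C h < n"
  shows "reachable (T + (2 * M - 1)) (\<lambda>x (v, h). A x h * found_amp x (C h) v)"
proof -
  have "reachable (T + 2 * i) (\<lambda>x (v, h). A x h * search_amp i x (C h) v)" for i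
  proof (induction i)
    case 0
    show ?case using reachable_prepare[OF assms] by simp
  next
    case (Suc i)
    show ?case using reachable_iterate[OF Suc C] by (simp add: add_ac)
  qed
  from reachable_query_rec[OF this[of "M - 1"]]
  have "reachable (Suc (T + 2 * (M - 1))) (\<lambda>x (v, h). A x h * found_amp x (C h) v)"
    by (simp add: found_amp_def)
  moreover have "Suc (T + 2 * (M - 1)) = T + (2 * M - 1)" using M_pos by simp
  ultimately show ?thesis by (simp only:)
qed

text \<open>Transposing 0 and \<open>p h\<close> in the position register moves the blank record to
  the position to be read; one query then writes its value.\<close>

lemma reachable_check:
  assumes "reachable T (\<lambda>x (v, h). of_bool (v = rec0) * A x h)" and p: "\<And>h. h \<in> H \<Longrightarrow> p h < N"
  shows "reachable (Suc T) (\<lambda>x (v, h). A x h * of_bool (v = (p h, x ! p h, 0, False)))"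
proof -
  define \<sigma> :: "qrec list \<Rightarrow> qrec \<Rightarrow> qrec" where
    "\<sigma> h = (\<lambda>(j, b, r, d). (Transposition.transpose 0 (p h) j, b, r, d))" for h
  have "reachable T (\<lambda>x (v, h). of_bool (\<sigma> h v = rec0) * A x h)"
  proof (rule reachable_relabel[OF assms(1)])
    fix h v assume "h \<in> H" "v \<in> V"
    then show "\<sigma> h v \<in> V \<and> \<sigma> h (\<sigma> h v) = v"
      using p[of h] N by (cases v) (auto simp: \<sigma>_def records_def Transposition.transpose_def)
  qed
  from reachable_query_rec[OF this] show ?thesis
  proof (rule reachable_cong)
    fix x :: "bool list" and k :: "qrec \<times> qrec list"
    obtain j b r d h where k: "k = ((j, b, r, d), h)" by (metis prod.exhaust)
    have "\<sigma> h (answer_flip x (j, b, r, d)) = rec0 \<longleftrightarrow> (j, b, r, d) = (p h, x ! p h, 0, False)"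
      by (auto simp: \<sigma>_def rec0_def Transposition.transpose_def split: if_splits)
    then show "(case k of (v, h) \<Rightarrow> of_bool (\<sigma> h (answer_flip x v) = rec0) * A x h)
        = (case k of (v, h) \<Rightarrow> A x h * of_bool (v = (p h, x ! p h, 0, False)))"
      unfolding k prod.case by simp
  qed
qed

text \<open>The loop invariant: the first \<open>t\<close> slots hold the history so far and all
  later slots are blank.\<close>

definition partial_amp :: "nat \<Rightarrow> bool list \<Rightarrow> qrec list \<Rightarrow> real" where
  "partial_amp t x h = of_bool (\<forall>i. t \<le> i \<and> i < 8 * n + m \<longrightarrow> h ! i = rec0) * amp x (take t h)"

lemma reachable_record:
  assumes "reachable T (\<lambda>x (v, h). partial_amp t x h * step_amp x (take t h) v)" and t: "t < 8 * n + m"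
  shows "reachable T (\<lambda>x (v, h). of_bool (v = rec0) * partial_amp (Suc t) x h)"
  using reachable_swap[OF assms]
proof (rule reachable_cong)
  fix x :: "bool list" and k assume "k \<in> V \<times> H"
  then obtain v h where k: "k = (v, h)" and len: "length h = 8 * n + m"
    by (auto simp: histories_def)
  have "(\<forall>i. t \<le> i \<and> i < 8 * n + m \<longrightarrow> h[t := v] ! i = rec0)
      \<longleftrightarrow> v = rec0 \<and> (\<forall>i. Suc t \<le> i \<and> i < 8 * n + m \<longrightarrow> h ! i = rec0)"
    using t len by (auto simp: nth_list_update Suc_le_eq)
  moreover have "amp x (take (Suc t) h) = amp x (take t h) * step_amp x (take t h) (h ! t)"
    using t len by (simp add: take_Suc_conv_app_nth amp_snoc)
  ultimately show "(case k of (v, h) \<Rightarrow> partial_amp t x (h[t := v]) * step_amp x (take t (h[t := v])) (h ! t))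
      = (case k of (v, h) \<Rightarrow> of_bool (v = rec0) * partial_amp (Suc t) x h)"
    by (simp add: k partial_amp_def)
qed

lemma reachable_rounds:
  "t \<le> 8 * n \<Longrightarrow> reachable (t * (2 * M - 1)) (\<lambda>x (v, h). of_bool (v = rec0) * partial_amp t x h)"
proof (induction t)
  case 0
  have "reachable 0 (\<lambda>x (v, h). of_bool (v = rec0) * partial_amp 0 x h)"
    using reachable_start
  proof (rule reachable_cong)
    fix x :: "bool list" and k assume "k \<in> V \<times> H"
    then obtain v h where k: "k = (v, h)" and len: "length h = 8 * n + m"
      by (auto simp: histories_def)
    have "(\<forall>i<8 * n + m. h ! i = rec0) \<longleftrightarrow> h = replicate (8 * n + m) rec0"
      using len by (auto simp: list_eq_iff_nth_eq)
    then show "of_bool (k = (rec0, replicate (8 * n + m) rec0))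
        = (case k of (v, h) \<Rightarrow> of_bool (v = rec0) * partial_amp 0 x h)"
      by (simp add: k partial_amp_def)
  qed
  then show ?case by simp
next
  case (Suc t)
  have "reachable (t * (2 * M - 1) + (2 * M - 1))
      (\<lambda>x (v, h). partial_amp t x h * found_amp x (current (take t h)) v)"
    using Suc by (intro reachable_search current_less) auto
  then have "reachable (Suc t * (2 * M - 1)) (\<lambda>x (v, h). partial_amp t x h * found_amp x (current (take t h)) v)"
    by (simp add: add.commute)
  then have "reachable (Suc t * (2 * M - 1)) (\<lambda>x (v, h). partial_amp t x h * step_amp x (take t h) v)"
    by (rule reachable_cong) (use Suc.prems in \<open>auto simp: step_amp_def rounds_def histories_def\<close>)
  then show ?case by (rule reachable_record) (use Suc.prems m in simp)
qed

lemma reachable_checks: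
  "s \<le> m \<Longrightarrow> reachable (8 * n * (2 * M - 1) + s)
     (\<lambda>x (v, h). of_bool (v = rec0) * partial_amp (8 * n + s) x h)"
proof (induction s)
  case 0
  show ?case using reachable_rounds[of "8 * n"] by simp
next
  case (Suc s)
  let ?p = "\<lambda>h. checked (take (8 * n + s) h)"
  have "reachable (Suc (8 * n * (2 * M - 1) + s))
      (\<lambda>x (v, h). partial_amp (8 * n + s) x h * of_bool (v = (?p h, x ! ?p h, 0, False)))"
  proof (rule reachable_check)
    fix h assume "h \<in> H"
    then show "?p h < N"
      using Suc.prems by (intro checked_less) (auto simp: histories_def rounds_def)
  qed (use Suc in simp)
  then have "reachable (Suc (8 * n * (2 * M - 1) + s))
      (\<lambda>x (v, h). partial_amp (8 * n + s) x h * step_amp x (take (8 * n + s) h) v)"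
    by (rule reachable_cong) (use Suc.prems in \<open>auto simp: step_amp_def rounds_def histories_def\<close>)
  from reachable_record[OF this] show ?case using Suc.prems by simp
qed

lemma zero_error_algorithm:
  "\<exists>U out. zero_error_quantum N (and_of_ors n B) (8 * n * (2 * M - 1) + m) W U out"
proof (rule zero_error_quantumI)
  show "reachable (8 * n * (2 * M - 1) + m) (\<lambda>x (v, h). of_bool (v = rec0) * amp x h)"
    using reachable_checks[OF order_refl]
    by (rule reachable_cong) (auto simp: partial_amp_def histories_def)
next
  fix x :: "bool list" and k assume "k \<in> V \<times> H" and nz: "(case k of (v, h) \<Rightarrow> of_bool (v = rec0) * amp x h) \<noteq> 0"
  then obtain v h where k: "k = (v, h)" and len: "length h = rounds + m"
    by (auto simp: histories_def rounds_def)
  show "verdict (snd k) \<noteq> Some (\<not> and_of_ors n B x)"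
    using verdict_correct[OF _ len] nz by (auto simp: k)
next
  fix x :: "bool list"
  \<comment> \<open>Markov's inequality: half the potential is at least 1 on every inconclusive
    history of nonzero amplitude, and its expectation is at most 1/2.\<close>
  let ?g = "\<lambda>h. (amp x h)\<^sup>2 * (potential x (take rounds h) / 2)"
  have nonneg: "potential x h \<ge> 0" for h by (simp add: potential_def)
  have "(\<Sum>k | k \<in> V \<times> H \<and> verdict (snd k) = None. (case k of (v, h) \<Rightarrow> of_bool (v = rec0) * amp x h)\<^sup>2)
      \<le> (\<Sum>k\<in>V \<times> H. (if fst k = rec0 then ?g (snd k) else 0))"
  proof (rule sum_le_included[where i = id])
    show "\<forall>k\<in>{k \<in> V \<times> H. verdict (snd k) = None}. \<exists>k'\<in>V \<times> H. id k' = k \<and>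
        (case k of (v, h) \<Rightarrow> of_bool (v = rec0) * amp x h)\<^sup>2 \<le> (if fst k' = rec0 then ?g (snd k') else 0)"
    proof
      fix k assume "k \<in> {k \<in> V \<times> H. verdict (snd k) = None}"
      then obtain v h where k: "k = (v, h)" "k \<in> V \<times> H" and len: "length h = rounds + m" and none: "verdict h = None"
        by (auto simp: histories_def rounds_def)
      have "(amp x h)\<^sup>2 * 1 \<le> ?g h"
        using verdict_None[OF _ len none, of x] by (cases "amp x h = 0") (auto intro: mult_left_mono)
      then show "\<exists>k'\<in>V \<times> H. id k' = k \<and>
          (case k of (v, h) \<Rightarrow> of_bool (v = rec0) * amp x h)\<^sup>2 \<le> (if fst k' = rec0 then ?g (snd k') else 0)"
        using k by (intro bexI[of _ k]) auto
    qed
  qed (auto simp: finite_records finite_histories nonneg)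
  also have "\<dots> = (\<Sum>v\<in>V. if v = rec0 then \<Sum>h\<in>H. ?g h else 0)"
    unfolding sum.cartesian_product' by (intro sum.cong) auto
  also have "\<dots> = (\<Sum>h\<in>H. ?g h)"
    using rec0_in_records[OF N M] finite_records by simp
  also have "\<dots> = prob_sum x (rounds + m) (\<lambda>h. potential x (take rounds h)) / 2"
    by (simp add: prob_sum_def rounds_def sum_divide_distrib)
  also have "\<dots> \<le> 1 / 2" using prob_sum_potential by simp
  finally show "(\<Sum>k | k \<in> V \<times> H \<and> verdict (snd k) = None. (case k of (v, h) \<Rightarrow> of_bool (v = rec0) * amp x h)\<^sup>2) \<le> 1 / 2" .
qed

end

lemma zero_error_upper_bound:
  assumes "equal_blocks N n m B" "n > 0" "m > 0" "M > 0" "m \<le> M\<^sup>2"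
  shows "\<exists>W>0. \<exists>U out. zero_error_quantum N (and_of_ors n B) (8 * n * (2 * M - 1) + m) W U out"
proof -
  interpret block_search N n m M B by unfold_locales (use assms in auto)
  interpret record_basis N M "8 * n + m" by unfold_locales (use N_pos M_pos in auto)
  obtain W idx where W: "W > 0"
    and basis: "labelled_basis N W (V \<times> H) idx (rec0, replicate (8 * n + m) rec0) flip_fst"
    using basis_exists by blast
  interpret labelled_basis N W "V \<times> H" idx "(rec0, replicate (8 * n + m) rec0)" flip_fst by (rule basis)
  interpret block_search_algorithm N n m M B W idx by unfold_locales
  show ?thesis using zero_error_algorithm W by blast
qed

section \<open>The complexities of the AND of ORs\<close>

lemma Q0_bounds:
  assumes B: "equal_blocks (n ^ 3) n (n ^ 2) B" and n: "n > 0"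
  shows "n ^ 2 \<le> Q0 (n ^ 3) (and_of_ors n B)" and "Q0 (n ^ 3) (and_of_ors n B) \<le> 17 * n ^ 2"
proof -
  let ?P = "\<lambda>T. \<exists>W>0. \<exists>U out. zero_error_quantum (n ^ 3) (and_of_ors n B) T W U out"
  \<comment> \<open>With \<open>M = n\<close>, the requirement \<open>m <= M ^ 2\<close> is met with
    equality. The constant 17 is 16 for \<open>8 * n\<close> runs of fewer than \<open>2 * n\<close>
    queries, plus 1 for the \<open>n ^ 2\<close> checks.\<close>
  have P: "?P (8 * n * (2 * n - 1) + n ^ 2)"
    using B n by (intro zero_error_upper_bound) auto
  have "?P (Q0 (n ^ 3) (and_of_ors n B))"
    unfolding Q0_def by (rule LeastI[of ?P, OF P])
  then show "n ^ 2 \<le> Q0 (n ^ 3) (and_of_ors n B)"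
    using zero_error_lower_bound[OF B n] n by auto
  have "Q0 (n ^ 3) (and_of_ors n B) \<le> 8 * n * (2 * n - 1) + n ^ 2"
    unfolding Q0_def by (rule Least_le[of ?P, OF P])
  also have "8 * n * (2 * n - 1) \<le> 8 * n * (2 * n)" by (intro mult_le_mono2) simp
  finally show "Q0 (n ^ 3) (and_of_ors n B) \<le> 17 * n ^ 2" by (simp add: power2_eq_square)
qed

theorem theorem10:
  fixes B :: "nat \<Rightarrow> nat \<Rightarrow> nat set" and f :: "nat \<Rightarrow> bool list \<Rightarrow> bool"
  assumes "\<And>n. equal_blocks (n ^ 3) n (n ^ 2) (B n)"
    and "\<And>n. f n = and_of_ors n (B n)"
  shows "(\<lambda>n. real (Q0 (n ^ 3) (f n))) \<in> \<Theta>(\<lambda>n. real (n ^ 3) powr (2 / 3)) \<and>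
         (\<lambda>n. real (R2 (n ^ 3) (f n))) \<in> \<Omega>(\<lambda>n. real (n ^ 3))"
proof -
  have pow: "real (n ^ 3) powr (2 / 3) = real (n ^ 2)" if "n > 0" for n :: nat
  proof -
    have "real (n ^ 3) powr (2 / 3) = (real n powr 3) powr (2 / 3)"
      using that by (simp add: powr_numeral)
    also have "\<dots> = real n powr 2" unfolding powr_powr by simp
    also have "\<dots> = real (n ^ 2)" using that by (simp add: powr_numeral)
    finally show ?thesis .
  qed
  have Q: "real (n ^ 3) powr (2 / 3) \<le> real (Q0 (n ^ 3) (f n))"
      "real (Q0 (n ^ 3) (f n)) \<le> 17 * real (n ^ 3) powr (2 / 3)" if "n > 0" for n
  proof -
    show "real (n ^ 3) powr (2 / 3) \<le> real (Q0 (n ^ 3) (f n))"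
      unfolding pow[OF that] assms(2) of_nat_le_iff by (rule Q0_bounds(1)[OF assms(1) that])
    have "real (Q0 (n ^ 3) (f n)) \<le> real (17 * n ^ 2)"
      unfolding assms(2) of_nat_le_iff by (rule Q0_bounds(2)[OF assms(1) that])
    then show "real (Q0 (n ^ 3) (f n)) \<le> 17 * real (n ^ 3) powr (2 / 3)"
      unfolding pow[OF that] by simp
  qed
  have R: "real (n ^ 3) \<le> 6 * real (R2 (n ^ 3) (f n))" if "n > 0" for n
  proof -
    have "n ^ 2 * n \<le> 6 * R2 (n ^ 3) (f n)"
      unfolding assms(2) using that by (intro R2_lower_bound assms(1)) simp
    then have "real (n ^ 2 * n) \<le> real (6 * R2 (n ^ 3) (f n))" by (simp only: of_nat_le_iff)
    then show ?thesis by (simp add: power3_eq_cube power2_eq_square)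
  qed
  have "(\<lambda>n. real (Q0 (n ^ 3) (f n))) \<in> O(\<lambda>n. real (n ^ 3) powr (2 / 3))"
    by (rule bigoI[of _ 17], rule eventually_mono[OF eventually_gt_at_top[of 0]]) (use Q(2) in simp)
  moreover have "(\<lambda>n. real (Q0 (n ^ 3) (f n))) \<in> \<Omega>(\<lambda>n. real (n ^ 3) powr (2 / 3))"
    by (rule landau_omega.bigI[of 1], simp, rule eventually_mono[OF eventually_gt_at_top[of 0]])
       (use Q(1) in simp)
  moreover have "(\<lambda>n. real (R2 (n ^ 3) (f n))) \<in> \<Omega>(\<lambda>n. real (n ^ 3))"
    by (rule landau_omega.bigI[of "1 / 6"], simp, rule eventually_mono[OF eventually_gt_at_top[of 0]])
       (use R in \<open>simp add: field_simps\<close>)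
  ultimately show ?thesis by (blast intro: bigthetaI)
qed

end
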